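(* Let $G$ be a finite group acting transitively on a finite set $\Omega$ with $|\Omega|\geq 2$, let $S$ be any subset of $G$, let $\chi_S:G\to\mathbb{R}$ be the characteristic function of $S$, and let $f:\Omega\to\mathbb{R}$ be a function that satisfies $\sum_{x\in\Omega}f(x)=0$. Then $$\|\chi_S\ast_c f\|\leq \sqrt{\ell_S|\Omega|/m_H}\cdot\|\chi_S\|\cdot\|f\|,$$ where $\ell_S=\max\{|g_1Hg_2\cap S| \,\mid\, g_1,g_2\in G\}$.
   Context: Group actions are written on the left. $H=\mathrm{Stab}_G(\omega)$ is the stabilizer in $G$ of some element $\omega\in\Omega$; $1_H^G$ is the (complex) permutation representation of $G$ on the left cosets of $H$ (equivalently, on $\Omega$). $m_H$ is the minimum multiplicity, in $1_H^G$, of a non-trivial irreducible component of $1_H^G$ (such a component exists as $|\Omega|\geq 2$). The norm of a function $Z:\Lambda\to\mathbb{R}$ on a finite set is $\|Z\|=\left(\sum_{\lambda\in\Lambda}Z(\lambda)^2\right)^{1/2}$. For $X:G\to\mathbb{R}$ and $Y:\Omega\to\mathbb{R}$, the convolution $X\ast_c Y:\Omega\to\mathbb{R}$ is $(X\ast_c Y)(\omega)=\sum_{g\in G}X(g)Y(g^{-1}\omega)$. *)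

theory Defs
  imports
    "HOL-Analysis.L2_Norm"
    "HOL-Library.Indicator_Function"
    "HOL-Library.Function_Algebras"
    "HOL-Algebra.Group_Action"
    "HOL-Algebra.Left_Coset"
begin

section \<open>Linear representations and multiplicities\<close>

locale linear_rep = vector_space scale + group G
  for scale :: "'k::field \<Rightarrow> 'v::ab_group_add \<Rightarrow> 'v"
    and G :: "('g, 'm) monoid_scheme" (structure) +
  fixes V :: "'v set" and \<rho> :: "'g \<Rightarrow> 'v \<Rightarrow> 'v"
  assumes subspace_V: "subspace V"
    and rep_closed: "\<lbrakk>g \<in> carrier G; v \<in> V\<rbrakk> \<Longrightarrow> \<rho> g v \<in> V"
    and rep_add: "\<lbrakk>g \<in> carrier G; v \<in> V; w \<in> V\<rbrakk> \<Longrightarrow> \<rho> g (v + w) = \<rho> g v + \<rho> g w"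
    and rep_scale: "\<lbrakk>g \<in> carrier G; v \<in> V\<rbrakk> \<Longrightarrow> \<rho> g (scale c v) = scale c (\<rho> g v)"
    and rep_one: "v \<in> V \<Longrightarrow> \<rho> \<one> v = v"
    and rep_mult: "\<lbrakk>g \<in> carrier G; h \<in> carrier G; v \<in> V\<rbrakk> \<Longrightarrow> \<rho> (g \<otimes> h) v = \<rho> g (\<rho> h v)"
begin

definition subrep :: "'v set \<Rightarrow> bool" where
  "subrep U \<longleftrightarrow> subspace U \<and> U \<subseteq> V \<and> (\<forall>g\<in>carrier G. \<forall>u\<in>U. \<rho> g u \<in> U)"

definition irreducible_subrep :: "'v set \<Rightarrow> bool" where
  "irreducible_subrep U \<longleftrightarrow> subrep U \<and> U \<noteq> {0} \<and>
     (\<forall>U'. subrep U' \<and> U' \<subseteq> U \<longrightarrow> U' = {0} \<or> U' = U)"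

text \<open>For an irreducible \<open>U\<close>, a pointwise trivial action means that \<open>U\<close> is
  the one-dimensional trivial representation.\<close>

definition acts_trivially :: "'v set \<Rightarrow> bool" where
  "acts_trivially U \<longleftrightarrow> (\<forall>g\<in>carrier G. \<forall>u\<in>U. \<rho> g u = u)"

definition subrep_iso :: "'v set \<Rightarrow> 'v set \<Rightarrow> bool" where
  "subrep_iso U W \<longleftrightarrow> (\<exists>T. bij_betw T U W \<and>
     (\<forall>u\<in>U. \<forall>u'\<in>U. T (u + u') = T u + T u') \<and>
     (\<forall>c. \<forall>u\<in>U. T (scale c u) = scale c (T u)) \<and>
     (\<forall>g\<in>carrier G. \<forall>u\<in>U. T (\<rho> g u) = \<rho> g (T u)))"

text \<open>\<open>V\<close> is the internal direct sum of the irreducible subrepresentations in \<open>D\<close>. Isomorphic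
  summands are different elements of \<open>D\<close>, since the summands are nonzero and independent.\<close>

definition irreducible_decomposition :: "'v set set \<Rightarrow> bool" where
  "irreducible_decomposition D \<longleftrightarrow> finite D \<and> (\<forall>U\<in>D. irreducible_subrep U) \<and>
     (\<forall>v\<in>V. \<exists>!x. x \<in> (\<Pi>\<^sub>E U\<in>D. U) \<and> v = (\<Sum>U\<in>D. x U))"

text \<open>The number of summands isomorphic to \<open>U\<close> does not depend on the decomposition
  (Krull--Schmidt), so the choice is immaterial.\<close>

definition multiplicity :: "'v set \<Rightarrow> nat" where
  "multiplicity U = (SOME k. \<exists>D. irreducible_decomposition D \<and> k = card {U' \<in> D. subrep_iso U' U})"

definition min_nontrivial_multiplicity :: nat where
  "min_nontrivial_multiplicity =
     Min (multiplicity ` {U. irreducible_subrep U \<and> \<not> acts_trivially U})"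

end

section \<open>Complex permutation representations\<close>

definition cscale :: "complex \<Rightarrow> ('b \<Rightarrow> complex) \<Rightarrow> 'b \<Rightarrow> complex" where
  "cscale c F = (\<lambda>x. c * F x)"

text \<open>The space of complex functions on \<open>E\<close>, represented by their extensions by zero.\<close>

definition perm_space :: "'b set \<Rightarrow> ('b \<Rightarrow> complex) set" where
  "perm_space E = {F. \<forall>x. x \<notin> E \<longrightarrow> F x = 0}"

definition perm_rep ::
  "('g, 'm) monoid_scheme \<Rightarrow> 'b set \<Rightarrow> ('g \<Rightarrow> 'b \<Rightarrow> 'b) \<Rightarrow> 'g \<Rightarrow> ('b \<Rightarrow> complex) \<Rightarrow> 'b \<Rightarrow> complex" where
  "perm_rep G E \<phi> g F = (\<lambda>x. if x \<in> E then F (\<phi> (inv\<^bsub>G\<^esub> g) x) else 0)"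

lemma linear_rep_perm_rep:
  fixes E :: "'b set"
  assumes "group_action G E \<phi>"
  shows "linear_rep cscale G (perm_space E) (perm_rep G E \<phi>)"
proof -
  interpret group_action G E \<phi> by fact
  interpret group G using group_hom by (rule group_hom.axioms(1))
  interpret vector_space cscale
    by unfold_locales (auto simp: cscale_def fun_eq_iff algebra_simps)
  show ?thesis
  proof unfold_locales
    show "subspace (perm_space E)"
      by (auto simp: subspace_def perm_space_def cscale_def)
  next
    fix v :: "'b \<Rightarrow> complex" assume "v \<in> perm_space E"
    moreover have "\<phi> \<one>\<^bsub>G\<^esub> x = x" if "x \<in> E" for x
      using id_eq_one that by (metis restrict_apply')
    ultimately show "perm_rep G E \<phi> \<one>\<^bsub>G\<^esub> v = v"
      by (auto simp: perm_rep_def perm_space_def fun_eq_iff)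
  next
    fix g h and v :: "'b \<Rightarrow> complex"
    assume "g \<in> carrier G" "h \<in> carrier G" "v \<in> perm_space E"
    moreover from this have "\<phi> (inv\<^bsub>G\<^esub> g) x \<in> E" if "x \<in> E" for x
      using element_image that by blast
    ultimately show "perm_rep G E \<phi> (g \<otimes>\<^bsub>G\<^esub> h) v = perm_rep G E \<phi> g (perm_rep G E \<phi> h v)"
      by (simp add: perm_rep_def fun_eq_iff inv_mult_group composition_rule)
  qed (auto simp: perm_rep_def perm_space_def cscale_def fun_eq_iff)
qed

definition coset_action ::
  "('g, 'm) monoid_scheme \<Rightarrow> 'g set \<Rightarrow> 'g \<Rightarrow> 'g set \<Rightarrow> 'g set" where
  "coset_action G H g = (\<lambda>C\<in>lcosets\<^bsub>G\<^esub> H. g <#\<^bsub>G\<^esub> C)"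

lemma group_action_coset_action:
  assumes "group G" "subgroup H G"
  shows "group_action G (lcosets\<^bsub>G\<^esub> H) (coset_action G H)"
proof -
  interpret group G by fact
  have sub: "C \<subseteq> carrier G" if "C \<in> lcosets\<^bsub>G\<^esub> H" for C
    using subgroup.lcosets_carrier[OF assms(2,1) that] .
  have mult: "g <#\<^bsub>G\<^esub> (h <#\<^bsub>G\<^esub> C) = (g \<otimes>\<^bsub>G\<^esub> h) <#\<^bsub>G\<^esub> C"
    if "g \<in> carrier G" "h \<in> carrier G" "C \<in> lcosets\<^bsub>G\<^esub> H" for g h C
    using lcos_m_assoc[OF sub] that by blast
  have one: "\<one>\<^bsub>G\<^esub> <#\<^bsub>G\<^esub> C = C" if "C \<in> lcosets\<^bsub>G\<^esub> H" for C
    using lcos_mult_one[OF sub[OF that]] .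
  have closed: "g <#\<^bsub>G\<^esub> C \<in> lcosets\<^bsub>G\<^esub> H" if "g \<in> carrier G" "C \<in> lcosets\<^bsub>G\<^esub> H" for g C
    using that lcos_m_assoc[OF subgroup.subset[OF assms(2)]]
    unfolding LCOSETS_def by auto
  have bij: "bij_betw (coset_action G H g) (lcosets\<^bsub>G\<^esub> H) (lcosets\<^bsub>G\<^esub> H)"
    if g: "g \<in> carrier G" for g
    by (rule bij_betw_byWitness[where f' = "coset_action G H (inv\<^bsub>G\<^esub> g)"])
      (use g in \<open>auto simp: coset_action_def closed mult one\<close>)
  have hom: "coset_action G H (g \<otimes>\<^bsub>G\<^esub> h) =
      compose (lcosets\<^bsub>G\<^esub> H) (coset_action G H g) (coset_action G H h)"
    if "g \<in> carrier G" "h \<in> carrier G" for g h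
    using that by (intro ext) (simp add: coset_action_def compose_def mult closed)
  have Bij: "coset_action G H g \<in> Bij (lcosets\<^bsub>G\<^esub> H)" if "g \<in> carrier G" for g
    unfolding Bij_def using bij[OF that] by (simp add: coset_action_def)
  have "coset_action G H \<in> hom G (BijGroup (lcosets\<^bsub>G\<^esub> H))"
    by (rule homI) (simp_all add: BijGroup_def Bij hom)
  then show ?thesis
    by (simp add: group_action_def group_hom_def group_hom_axioms_def group_BijGroup assms)
qed

text \<open>\<open>m\<^sub>H\<close>, computed in the permutation representation on the left cosets of \<open>H\<close>.\<close>

definition min_mult :: "('g, 'm) monoid_scheme \<Rightarrow> 'g set \<Rightarrow> nat" where
  "min_mult G H =
     linear_rep.min_nontrivial_multiplicity cscale G (perm_space (lcosets\<^bsub>G\<^esub> H))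
       (perm_rep G (lcosets\<^bsub>G\<^esub> H) (coset_action G H))"

section \<open>Convolution and coset intersections\<close>

definition convolution ::
  "('g, 'm) monoid_scheme \<Rightarrow> ('g \<Rightarrow> 'b \<Rightarrow> 'b) \<Rightarrow> ('g \<Rightarrow> real) \<Rightarrow> ('b \<Rightarrow> real) \<Rightarrow> 'b \<Rightarrow> real" where
  "convolution G \<phi> X Y = (\<lambda>x. \<Sum>g\<in>carrier G. X g * Y (\<phi> (inv\<^bsub>G\<^esub> g) x))"

definition max_coset_inter :: "('g, 'm) monoid_scheme \<Rightarrow> 'g set \<Rightarrow> 'g set \<Rightarrow> nat" where
  "max_coset_inter G H S =
     Max {card (((g\<^sub>1 <#\<^bsub>G\<^esub> H) #>\<^bsub>G\<^esub> g\<^sub>2) \<inter> S) | g\<^sub>1 g\<^sub>2. g\<^sub>1 \<in> carrier G \<and> g\<^sub>2 \<in> carrier G}"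

end

(* Let A be the convolution by the characteristic function of S, acting on complex functions on
   the set E of cosets of H. Its entry at (x, y) is the number of s in S with s y = x, which is at most l_S,
   and every column sums to |S|; hence the squared Hilbert-Schmidt norm of A is at most
   l_S |S| |E|. Since A preserves subrepresentations and commutes with intertwining maps, a unit
   vector u of a nontrivial irreducible subrepresentation U has an orthonormal family of mult(U)
   isometric copies, one in each of mult(U) orthogonal copies of U, which A all maps to vectors of
   norm ||A u||. Summing over this family gives mult(U) ||A u||^2 <= l_S |S| |E|. A function of
   sum zero is an orthogonal sum of components in nontrivial irreducible subrepresentations, and
   the squared norms add up on both sides.

   To orthogonalise the summands of a decomposition that need not be orthogonal, each one is
   projected onto the complement of the preceding ones. By Schur's lemma the projection is a
   multiple of an isometry, and by independence it is not zero. *)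
theory Submission
  imports Defs "HOL-Computational_Algebra.Fundamental_Theorem_Algebra"
begin

section \<open>Eigenvectors\<close>

text \<open>Among the nonzero polynomials \<open>p\<close> for which \<open>p(M)\<close> kills some
  nonzero vector \<open>w\<close> of \<open>U\<close>, take one of least degree. It has a root
  \<open>a\<close>; with \<open>p = (X - a) q\<close>, the vector \<open>q(M) w\<close> is nonzero
  by minimality and is an eigenvector for \<open>a\<close>.\<close>

lemma exists_eigenvector:
  fixes scale :: "complex \<Rightarrow> 'v::ab_group_add \<Rightarrow> 'v"
  assumes "vector_space scale"
    and U: "module.subspace scale U" "U \<noteq> {0}"
    and B: "finite B" "U \<subseteq> module.span scale B"
    and M: "\<And>u. u \<in> U \<Longrightarrow> M u \<in> U"
      "\<And>u w. \<lbrakk>u \<in> U; w \<in> U\<rbrakk> \<Longrightarrow> M (u + w) = M u + M w"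
      "\<And>c u. u \<in> U \<Longrightarrow> M (scale c u) = scale c (M u)"
  obtains a u where "u \<in> U" "u \<noteq> 0" "M u = scale a u"
proof -
  interpret vector_space scale by fact
  \<comment> \<open>This is \<open>p(M) w\<close>, the polynomial \<open>p\<close> evaluated at
    \<open>M\<close> and applied to \<open>w\<close>.\<close>
  define act where "act p w = (\<Sum>i\<le>degree p. scale (coeff p i) ((M ^^ i) w))" for p w
  have iter: "(M ^^ i) w \<in> U" if "w \<in> U" for i w
    by (induction i) (use that M in auto)
  have M_sum: "M (\<Sum>i\<in>I. scale (c i) (x i)) = (\<Sum>i\<in>I. scale (c i) (M (x i)))"
    if "\<And>i. i \<in> I \<Longrightarrow> x i \<in> U" for I :: "nat set" and c x
  proof -
    have "M 0 = 0"
      using M(3)[OF subspace_0[OF U(1)], of 0] by simp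
    with that show ?thesis
      by (induction I rule: infinite_finite_induct)
        (simp_all add: M(2,3) subspace_scale[OF U(1)] subspace_sum[OF U(1)])
  qed
  have act_closed: "act p w \<in> U" if "w \<in> U" for p w
    unfolding act_def by (intro subspace_sum subspace_scale U(1) iter that)
  have act_bound: "act p w = (\<Sum>i\<le>N. scale (coeff p i) ((M ^^ i) w))" if "degree p \<le> N" for p w N
    unfolding act_def by (rule sum.mono_neutral_left) (use that in \<open>auto simp: coeff_eq_0\<close>)
  have "\<exists>p w. p \<noteq> 0 \<and> w \<in> U \<and> w \<noteq> 0 \<and> act p w = 0"
  proof -
    obtain w where w: "w \<in> U" "w \<noteq> 0"
      using U subspace_0[OF U(1)] by blast
    define n where "n = card B"
    define z where "z i = (M ^^ i) w" for i
    show ?thesis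
    \<comment> \<open>The iterates \<open>z 0, ..., z n\<close> are \<open>card B + 1\<close>
      vectors in the span of \<open>B\<close>. Distinct ones are linearly dependent and the
      coefficients give \<open>p\<close>. A repetition is invisible to the dependence of a set and
      is treated apart, with \<open>X^i - X^j\<close>.\<close>
    proof (cases "inj_on z {..n}")
      case True
      have "\<not> independent (z ` {..n})"
      proof
        assume "independent (z ` {..n})"
        moreover have "z ` {..n} \<subseteq> span B"
          using B(2) iter[OF w(1)] by (auto simp: z_def)
        ultimately have "card (z ` {..n}) \<le> card B"
          using independent_span_bound[OF B(1)] by blast
        then show False
          using True by (simp add: card_image n_def)
      qed
      then obtain c i where c: "i \<le> n" "c (z i) \<noteq> 0" "(\<Sum>v\<in>z ` {..n}. scale (c v) v) = 0"
        unfolding dependent_finite[OF finite_imageI[OF finite_atMost]] by auto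
      define p where "p = (\<Sum>i\<le>n. monom (c (z i)) i)"
      have coeff_p: "coeff p j = (if j \<le> n then c (z j) else 0)" for j
        by (simp add: p_def coeff_sum if_distrib cong: if_cong)
      have "degree p \<le> n"
        by (rule degree_le) (simp add: coeff_p)
      then have "act p w = (\<Sum>i\<le>n. scale (c (z i)) (z i))"
        by (simp add: act_bound z_def coeff_p)
      also have "\<dots> = 0"
        using c(3) True by (simp add: sum.reindex)
      finally have "act p w = 0" .
      moreover have "p \<noteq> 0"
        using coeff_p[of i] c by auto
      ultimately show ?thesis
        using w by blast
    next
      case False
      then obtain i j where ij: "i < j" "z i = z j"
        by (metis (no_types, lifting) inj_onI linorder_neqE_nat)
      define p where "p = monom (1::complex) i - monom 1 j"
      have coeff_p: "coeff p k = (if k = i then 1 else 0) - (if k = j then 1 else 0)" for k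
        by (auto simp: p_def)
      have "degree p \<le> j"
        by (rule degree_le) (use ij in \<open>simp add: coeff_p\<close>)
      then have "act p w = (\<Sum>k\<le>j. (if k = i then z i else 0) - (if k = j then z j else 0))"
        unfolding act_bound[OF \<open>degree p \<le> j\<close>]
        by (intro sum.cong) (auto simp: z_def coeff_p)
      also have "\<dots> = 0"
        using ij by (simp add: sum_subtractf)
      finally have "act p w = 0" .
      moreover have "p \<noteq> 0"
        using coeff_p[of i] ij by auto
      ultimately show ?thesis
        using w by blast
    qed
  qed
  then obtain p where p: "p \<noteq> 0" "\<exists>w. w \<in> U \<and> w \<noteq> 0 \<and> act p w = 0"
    and p_min: "\<And>q. \<lbrakk>q \<noteq> 0; \<exists>w. w \<in> U \<and> w \<noteq> 0 \<and> act q w = 0\<rbrakk> \<Longrightarrow> degree p \<le> degree q"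
    using ex_has_least_nat[of "\<lambda>p. p \<noteq> 0 \<and> (\<exists>w. w \<in> U \<and> w \<noteq> 0 \<and> act p w = 0)" _ degree] by metis
  then obtain w where w: "w \<in> U" "w \<noteq> 0" "act p w = 0"
    by blast
  have "degree p \<noteq> 0"
  proof
    assume "degree p = 0"
    then obtain c where "p = [:c:]"
      by (metis degree_eq_zeroE)
    then show False
      using p(1) w by (simp add: act_def)
  qed
  then obtain a where "poly p a = 0"
    using fundamental_theorem_of_algebra[of p] constant_degree[of p] by auto
  then obtain q where q: "p = [:- a, 1:] * q"
    using poly_eq_0_iff_dvd by blast
  with p(1) have "q \<noteq> 0"
    by auto
  then have deg: "degree p = Suc (degree q)"
    unfolding q by (subst degree_mult_eq) auto
  \<comment> \<open>\<open>pCons 0 q\<close> is \<open>X q\<close>, so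
    \<open>p(M) w = M (q(M) w) - a q(M) w\<close> can be checked coefficient by coefficient.\<close>
  have coeff_p: "coeff p i = coeff (pCons 0 q) i - a * coeff q i" for i
    by (simp add: q)
  have "0 = (\<Sum>i\<le>Suc (degree q). scale (coeff (pCons 0 q) i) ((M ^^ i) w))
      - (\<Sum>i\<le>Suc (degree q). scale (a * coeff q i) ((M ^^ i) w))"
    using w(3) unfolding act_def deg coeff_p by (simp add: scale_left_diff_distrib sum_subtractf)
  also have "(\<Sum>i\<le>Suc (degree q). scale (a * coeff q i) ((M ^^ i) w)) = scale a (act q w)"
    by (subst act_bound[of _ "Suc (degree q)"]) (simp_all only: scale_sum_right scale_scale order.refl le_SucI)
  also have "(\<Sum>i\<le>Suc (degree q). scale (coeff (pCons 0 q) i) ((M ^^ i) w)) = M (act q w)"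
    unfolding act_def
    by (subst sum.atMost_Suc_shift) (simp add: M_sum iter w(1))
  finally have "M (act q w) = scale a (act q w)"
    by simp
  moreover have "act q w \<noteq> 0"
    using p_min[OF \<open>q \<noteq> 0\<close>] w deg by fastforce
  ultimately show thesis
    using that act_closed[OF w(1)] by blast
qed

section \<open>Orthonormal families and projections\<close>

lemma sum_fun_apply: "(\<Sum>i\<in>I. F i) x = (\<Sum>i\<in>I. F i x)"
  by (induction I rule: infinite_finite_induct) auto

section \<open>The Hermitian inner product and its squared norm\<close>

definition ip :: "'b set \<Rightarrow> ('b \<Rightarrow> complex) \<Rightarrow> ('b \<Rightarrow> complex) \<Rightarrow> complex" where
  "ip E u w = (\<Sum>x\<in>E. u x * cnj (w x))"

definition nsq :: "'b set \<Rightarrow> ('b \<Rightarrow> complex) \<Rightarrow> real" where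
  "nsq E u = (\<Sum>x\<in>E. (cmod (u x))\<^sup>2)"

lemma ip_self: "ip E u u = of_real (nsq E u)"
  by (simp only: ip_def nsq_def of_real_sum complex_norm_square)

lemma nsq_eq_Re: "nsq E u = Re (ip E u u)"
  by (simp add: ip_self)

lemma nsq_nonneg: "nsq E u \<ge> 0"
  by (simp add: nsq_def sum_nonneg)

lemma ip_commute: "ip E w u = cnj (ip E u w)"
  by (simp add: ip_def mult.commute)

lemma ip_eq_0_commute: "ip E w u = 0 \<longleftrightarrow> ip E u w = 0"
  by (subst ip_commute) simp

lemma ip_add_left: "ip E (u + v) w = ip E u w + ip E v w"
  by (simp add: ip_def distrib_right sum.distrib)

lemma ip_add_right: "ip E w (u + v) = ip E w u + ip E w v"
  by (simp add: ip_def distrib_left sum.distrib)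

lemma ip_diff_left: "ip E (u - v) w = ip E u w - ip E v w"
  by (simp add: ip_def left_diff_distrib sum_subtractf)

lemma ip_diff_right: "ip E w (u - v) = ip E w u - ip E w v"
  by (simp add: ip_def right_diff_distrib sum_subtractf)

lemma ip_scale_left: "ip E (cscale c u) w = c * ip E u w"
  by (simp add: ip_def cscale_def sum_distrib_left mult.assoc)

lemma ip_scale_right: "ip E w (cscale c u) = cnj c * ip E w u"
  by (simp add: ip_def cscale_def sum_distrib_left mult.left_commute)

lemma ip_zero_left: "ip E 0 w = 0" and ip_zero_right: "ip E w 0 = 0"
  by (simp_all add: ip_def)

lemma ip_sum_left: "ip E (\<Sum>i\<in>I. F i) w = (\<Sum>i\<in>I. ip E (F i) w)"
  unfolding ip_def sum_fun_apply sum_distrib_right by (rule sum.swap)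

lemma ip_sum_right: "ip E w (\<Sum>i\<in>I. F i) = (\<Sum>i\<in>I. ip E w (F i))"
  unfolding ip_def sum_fun_apply cnj_sum sum_distrib_left by (rule sum.swap)

lemmas ip_simps = ip_add_left ip_add_right ip_diff_left ip_diff_right ip_scale_left ip_scale_right
  ip_zero_left ip_zero_right ip_sum_left ip_sum_right

lemma nsq_scale: "nsq E (cscale c u) = (cmod c)\<^sup>2 * nsq E u"
  by (simp add: nsq_def cscale_def norm_mult power_mult_distrib sum_distrib_left)

lemma nsq_eq_0_iff:
  assumes "finite E" "u \<in> perm_space E"
  shows "nsq E u = 0 \<longleftrightarrow> u = 0"
  using assms by (auto simp: nsq_def sum_nonneg_eq_0_iff perm_space_def fun_eq_iff)

lemma nsq_pos: "\<lbrakk>finite E; u \<in> perm_space E; u \<noteq> 0\<rbrakk> \<Longrightarrow> nsq E u > 0"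
  using nsq_eq_0_iff nsq_nonneg by (metis less_eq_real_def)

lemma exists_normalization:
  assumes "finite E" "u \<in> perm_space E" "u \<noteq> 0"
  obtains c where "c \<noteq> 0" "nsq E (cscale c u) = 1"
proof (rule that)
  show "complex_of_real (1 / sqrt (nsq E u)) \<noteq> 0"
    and "nsq E (cscale (complex_of_real (1 / sqrt (nsq E u))) u) = 1"
    using nsq_pos[OF assms] by (simp_all add: nsq_scale norm_divide power_divide)
qed

lemma nsq_orthogonal_sum:
  assumes "finite I" "\<And>i j. \<lbrakk>i \<in> I; j \<in> I; i \<noteq> j\<rbrakk> \<Longrightarrow> ip E (F i) (F j) = 0"
  shows "nsq E (\<Sum>i\<in>I. F i) = (\<Sum>i\<in>I. nsq E (F i))"
proof -
  have "ip E (\<Sum>i\<in>I. F i) (\<Sum>i\<in>I. F i) = (\<Sum>i\<in>I. \<Sum>j\<in>I. if i = j then ip E (F i) (F i) else 0)"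
    unfolding ip_sum_left ip_sum_right by (intro sum.cong) (auto simp: assms(2))
  then show ?thesis
    by (simp add: nsq_eq_Re assms(1) Re_sum)
qed

section \<open>Orthonormal families and Bessel's inequality\<close>

definition orthonormal :: "'b set \<Rightarrow> ('i \<Rightarrow> 'b \<Rightarrow> complex) \<Rightarrow> 'i set \<Rightarrow> bool" where
  "orthonormal E e I \<longleftrightarrow> (\<forall>i\<in>I. \<forall>j\<in>I. ip E (e i) (e j) = of_bool (i = j))"

lemma ip_orthonormal_sum:
  assumes "orthonormal E e I" "finite I" "j \<in> I"
  shows "ip E (\<Sum>i\<in>I. cscale (c i) (e i)) (e j) = c j"
proof -
  have "ip E (\<Sum>i\<in>I. cscale (c i) (e i)) (e j) = (\<Sum>i\<in>I. if i = j then c i else 0)"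
    unfolding ip_simps by (intro sum.cong) (use assms in \<open>auto simp: orthonormal_def\<close>)
  with assms show ?thesis
    by simp
qed

text \<open>The residual \<open>v - p\<close> of the expansion \<open>p\<close> of \<open>v\<close>
  is orthogonal to \<open>p\<close>, so its squared norm, which is nonnegative, is the difference of
  the two sides.\<close>

lemma bessel_inequality:
  assumes "orthonormal E e I" "finite I"
  shows "(\<Sum>i\<in>I. (cmod (ip E v (e i)))\<^sup>2) \<le> nsq E v"
proof -
  define p where "p = (\<Sum>i\<in>I. cscale (ip E v (e i)) (e i))"
  have "ip E (v - p) (e i) = 0" if "i \<in> I" for i
    using ip_orthonormal_sum[OF assms that] by (simp add: p_def ip_diff_left)
  then have "ip E (v - p) p = 0"
    by (simp add: p_def ip_sum_right ip_scale_right)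
  then have diff: "ip E (v - p) (v - p) = ip E v v - ip E p v"
    by (simp add: ip_diff_right ip_diff_left)
  have "ip E p v = (\<Sum>i\<in>I. of_real ((cmod (ip E v (e i)))\<^sup>2))"
    unfolding p_def ip_sum_left ip_scale_left
    by (intro sum.cong refl) (metis complex_norm_square ip_commute)
  then have "nsq E (v - p) = nsq E v - (\<Sum>i\<in>I. (cmod (ip E v (e i)))\<^sup>2)"
    by (simp only: nsq_eq_Re diff minus_complex.sel Re_sum Re_complex_of_real)
  then show ?thesis
    using nsq_nonneg[of E "v - p"] by linarith
qed

text \<open>Up to conjugation, \<open>A i x\<close> is the inner product of the conjugated row
  \<open>x\<close> of the matrix \<open>a\<close> with \<open>e i\<close>. Bessel's inequality for
  each row bounds the sum by the squared Hilbert-Schmidt norm of \<open>a\<close>.\<close>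

lemma sum_nsq_orthonormal_le:
  assumes "orthonormal E e I" "finite I"
    and A: "\<And>i x. \<lbrakk>i \<in> I; x \<in> E\<rbrakk> \<Longrightarrow> A i x = (\<Sum>y\<in>E. a x y * e i y)"
  shows "(\<Sum>i\<in>I. nsq E (A i)) \<le> (\<Sum>x\<in>E. \<Sum>y\<in>E. (cmod (a x y))\<^sup>2)"
proof -
  define b where "b x = (\<lambda>y. cnj (a x y))" for x
  have "(\<Sum>i\<in>I. nsq E (A i)) = (\<Sum>x\<in>E. \<Sum>i\<in>I. (cmod (ip E (b x) (e i)))\<^sup>2)"
  proof -
    have "cmod (A i x) = cmod (ip E (b x) (e i))" if "i \<in> I" "x \<in> E" for i x
    proof -
      have "ip E (b x) (e i) = cnj (A i x)"
        by (simp add: A[OF that] ip_def b_def)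
      then show ?thesis
        by simp
    qed
    then show ?thesis
      unfolding nsq_def by (subst sum.swap) simp
  qed
  also have "\<dots> \<le> (\<Sum>x\<in>E. nsq E (b x))"
    by (intro sum_mono bessel_inequality assms)
  also have "\<dots> = (\<Sum>x\<in>E. \<Sum>y\<in>E. (cmod (a x y))\<^sup>2)"
    by (simp add: nsq_def b_def)
  finally show ?thesis .
qed

text \<open>The Hilbert-Schmidt bound for the identity matrix. It serves as the dimension bound
  behind all maximality arguments below.\<close>

lemma card_orthonormal_le:
  assumes "orthonormal E e I" "finite I" "finite E"
  shows "card I \<le> card E"
proof -
  have "real (card I) = (\<Sum>i\<in>I. nsq E (e i))"
    using assms(1) by (simp add: orthonormal_def nsq_eq_Re)
  also have "\<dots> \<le> (\<Sum>x\<in>E. \<Sum>y\<in>E. (cmod (if x = y then 1 else 0))\<^sup>2)"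
    by (rule sum_nsq_orthonormal_le[OF assms(1,2)]) (simp add: assms(3) if_distrib[of "\<lambda>c. c * _"] cong: if_cong)
  also have "\<dots> = (\<Sum>x\<in>E. \<Sum>y\<in>E. if x = y then 1 else 0)"
    by (intro sum.cong) auto
  also have "\<dots> = real (card E)"
    using assms(3) by simp
  finally show ?thesis
    by simp
qed

section \<open>Orthonormal bases and orthogonal projections\<close>

interpretation cfun: vector_space cscale
  by unfold_locales (auto simp: cscale_def fun_eq_iff algebra_simps)

text \<open>Take an orthonormal subset of \<open>U\<close> of maximal size. A vector differing from
  its expansion leaves a nonzero residual orthogonal to \<open>B\<close>, and normalizing it would
  enlarge \<open>B\<close>.\<close>

lemma exists_orthonormal_basis:
  assumes E: "finite E" and U: "cfun.subspace U" "U \<subseteq> perm_space E"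
  obtains B where "finite B" "B \<subseteq> U" "orthonormal E id B"
    "\<And>u. u \<in> U \<Longrightarrow> u = (\<Sum>b\<in>B. cscale (ip E u b) b)"
proof -
  let ?P = "\<lambda>B. finite B \<and> B \<subseteq> U \<and> orthonormal E id B"
  have "?P {}"
    by (simp add: orthonormal_def)
  moreover have "\<forall>B. ?P B \<longrightarrow> card B < Suc (card E)"
    using card_orthonormal_le[OF _ _ E] by (metis le_imp_less_Suc)
  ultimately have "\<exists>B. ?P B \<and> (\<forall>B'. ?P B' \<longrightarrow> card B' \<le> card B)"
    by (rule ex_has_greatest_nat)
  then obtain B where B: "?P B" and max: "\<And>B'. ?P B' \<Longrightarrow> card B' \<le> card B"
    by metis
  have basis: "u = (\<Sum>b\<in>B. cscale (ip E u b) b)" if u: "u \<in> U" for u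
  proof (rule ccontr)
    define r where "r = u - (\<Sum>b\<in>B. cscale (ip E u b) b)"
    assume "u \<noteq> (\<Sum>b\<in>B. cscale (ip E u b) b)"
    then have "r \<noteq> 0"
      unfolding r_def right_minus_eq .
    have "r \<in> U"
      unfolding r_def
      using B u U(1) by (blast intro: cfun.subspace_diff cfun.subspace_sum cfun.subspace_scale)
    then obtain c where c: "nsq E (cscale c r) = 1"
      using exists_normalization[OF E _ \<open>r \<noteq> 0\<close>] U(2) by blast
    define e where "e = cscale c r"
    have "ip E r b = 0" if "b \<in> B" for b
      using ip_orthonormal_sum[of E id B b] B that by (simp add: r_def ip_diff_left)
    then have e_B: "ip E e b = 0" "ip E b e = 0" if "b \<in> B" for b
      using that by (simp_all add: e_def ip_simps ip_eq_0_commute[of E b])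
    have "ip E e e = 1"
      using c by (simp add: e_def ip_self)
    moreover have "e \<in> U"
      unfolding e_def by (intro cfun.subspace_scale U(1) \<open>r \<in> U\<close>)
    ultimately have "?P (insert e B)"
      using B e_B by (auto simp: orthonormal_def)
    moreover have "e \<notin> B"
      using e_B \<open>ip E e e = 1\<close> by force
    ultimately show False
      using max[of "insert e B"] B by simp
  qed
  show thesis
    by (rule that[OF _ _ _ basis]) (use B in simp_all)
qed

text \<open>The projection is characterised by its residual and not through a basis, so that its
  linearity and equivariance follow from uniqueness.\<close>

definition proj :: "'b set \<Rightarrow> ('b \<Rightarrow> complex) set \<Rightarrow> ('b \<Rightarrow> complex) \<Rightarrow> 'b \<Rightarrow> complex" where
  "proj E U v = (THE p. p \<in> U \<and> (\<forall>u\<in>U. ip E (v - p) u = 0))"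

text \<open>Two candidates differ by a vector of \<open>U\<close> that is orthogonal to itself,
  hence zero. The expansion of \<open>v\<close> in an orthonormal basis of \<open>U\<close> is a
  candidate.\<close>

lemma
  assumes E: "finite E" and U: "cfun.subspace U" "U \<subseteq> perm_space E"
  shows proj_in: "proj E U v \<in> U"
    and proj_orthogonal: "u \<in> U \<Longrightarrow> ip E (v - proj E U v) u = 0"
    and proj_unique: "\<lbrakk>p \<in> U; \<And>u. u \<in> U \<Longrightarrow> ip E (v - p) u = 0\<rbrakk> \<Longrightarrow> proj E U v = p"
proof -
  let ?Q = "\<lambda>p. p \<in> U \<and> (\<forall>u\<in>U. ip E (v - p) u = 0)"
  have unique: "p = q" if "?Q p" "?Q q" for p q
  proof -
    have "p - q \<in> U"
      using that cfun.subspace_diff[OF U(1)] by blast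
    then have "ip E (v - q) (p - q) - ip E (v - p) (p - q) = 0"
      using that by simp
    then have "ip E (p - q) (p - q) = 0"
      by (simp add: ip_diff_left)
    then have "p - q = 0"
      using nsq_eq_0_iff[OF E] \<open>p - q \<in> U\<close> U(2) by (auto simp: ip_self)
    then show ?thesis
      by simp
  qed
  obtain B where B: "finite B" "B \<subseteq> U" "orthonormal E id B"
    "\<And>u. u \<in> U \<Longrightarrow> u = (\<Sum>b\<in>B. cscale (ip E u b) b)"
    using exists_orthonormal_basis[OF E U] by metis
  define p where "p = (\<Sum>b\<in>B. cscale (ip E v b) b)"
  have "p \<in> U"
    unfolding p_def using B(2) by (auto intro!: cfun.subspace_sum cfun.subspace_scale U(1))
  have "ip E (v - p) b = 0" if "b \<in> B" for b
    using ip_orthonormal_sum[OF B(3,1), of b] that by (simp add: p_def ip_diff_left)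
  then have "ip E (v - p) u = 0" if "u \<in> U" for u
    by (subst B(4)[OF that]) (simp add: ip_sum_right ip_scale_right)
  then have "?Q p"
    using \<open>p \<in> U\<close> by blast
  then have "?Q (proj E U v)"
    unfolding proj_def by (rule theI[of ?Q]) (use unique \<open>?Q p\<close> in blast)
  then show "proj E U v \<in> U" "u \<in> U \<Longrightarrow> ip E (v - proj E U v) u = 0"
    and "\<lbrakk>p \<in> U; \<And>u. u \<in> U \<Longrightarrow> ip E (v - p) u = 0\<rbrakk> \<Longrightarrow> proj E U v = p" for p
    using unique by blast+
qed

section \<open>Unitarity of the permutation representation\<close>

text \<open>Transitivity is kept out of the locale. It enters first in
  \<open>proj_trivial_eq_0\<close>, to make invariant functions constant.\<close>

locale finite_action = group_action G E \<phi>
  for G :: "('g, 'm) monoid_scheme" (structure) and E :: "'b set" and \<phi> +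
  assumes finite_E: "finite E"

sublocale finite_action \<subseteq> linear_rep cscale G "perm_space E" "perm_rep G E \<phi>"
  by (rule linear_rep_perm_rep) (rule group_action_axioms)

context finite_action
begin

abbreviation V :: "('b \<Rightarrow> complex) set" where "V \<equiv> perm_space E"
abbreviation R :: "'g \<Rightarrow> ('b \<Rightarrow> complex) \<Rightarrow> 'b \<Rightarrow> complex" where "R \<equiv> perm_rep G E \<phi>"

lemma ip_R:
  assumes "g \<in> carrier G"
  shows "ip E (R g u) (R g w) = ip E u w"
proof -
  have "bij_betw (\<phi> (inv g)) E E"
    using assms inj_prop surj_prop by (simp add: bij_betw_def)
  then have "(\<Sum>x\<in>E. u (\<phi> (inv g) x) * cnj (w (\<phi> (inv g) x))) = ip E u w"
    unfolding ip_def by (rule sum.reindex_bij_betw)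
  then show ?thesis
    by (simp add: ip_def perm_rep_def)
qed

lemma R_inverse:
  assumes "g \<in> carrier G" "v \<in> V"
  shows "R g (R (inv g) v) = v"
  using assms rep_mult[of g "inv g" v] rep_one by simp

lemma ip_R_left:
  assumes "g \<in> carrier G" "w \<in> V"
  shows "ip E (R g u) w = ip E u (R (inv g) w)"
  using ip_R[OF assms(1), of u "R (inv g) w"] R_inverse[OF assms] by simp

lemma subrepD:
  assumes "subrep U"
  shows "subspace U" "U \<subseteq> V" "\<And>g u. \<lbrakk>g \<in> carrier G; u \<in> U\<rbrakk> \<Longrightarrow> R g u \<in> U"
  using assms by (auto simp: subrep_def)

lemma irreducibleD:
  assumes "irreducible_subrep U"
  shows "subrep U" "U \<noteq> {0}" "\<And>W. \<lbrakk>subrep W; W \<subseteq> U; W \<noteq> {0}\<rbrakk> \<Longrightarrow> W = U"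
  using assms by (auto simp: irreducible_subrep_def)

lemma exists_unit_vector:
  assumes "subrep U" "U \<noteq> {0}"
  obtains u where "u \<in> U" "nsq E u = 1"
proof -
  note sub = subrepD[OF assms(1)]
  obtain u where u: "u \<in> U" "u \<noteq> 0"
    using assms(2) subspace_0[OF sub(1)] by blast
  then obtain c where "nsq E (cscale c u) = 1"
    using exists_normalization[OF finite_E] sub(2) by blast
  then show thesis
    by (intro that[of "cscale c u"] subspace_scale[OF sub(1) u(1)])
qed

text \<open>By unitarity \<open>R g\<close> crosses the inner product as \<open>R (inv g)\<close>,
  under which \<open>X\<close> is stable. \<open>X\<close> is only a stable set, because a union of
  subrepresentations is among its uses.\<close>

lemma subrep_orthogonal:
  assumes "X \<subseteq> V" "\<And>g x. \<lbrakk>g \<in> carrier G; x \<in> X\<rbrakk> \<Longrightarrow> R g x \<in> X"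
  shows "subrep {v \<in> V. \<forall>x\<in>X. ip E v x = 0}"
  unfolding subrep_def
proof (intro conjI ballI)
  show "subspace {v \<in> V. \<forall>x\<in>X. ip E v x = 0}"
    using subspace_V by (auto simp: subspace_def ip_simps)
next
  fix g u assume g: "g \<in> carrier G" and u: "u \<in> {v \<in> V. \<forall>x\<in>X. ip E v x = 0}"
  have "ip E (R g u) x = 0" if "x \<in> X" for x
    using ip_R_left[OF g, of x u] that assms g u by auto
  then show "R g u \<in> {v \<in> V. \<forall>x\<in>X. ip E v x = 0}"
    using g u rep_closed by simp
qed blast

section \<open>Intertwining maps and Schur's lemma\<close>

text \<open>The codomain is all of \<open>V\<close>, so that maps into different subrepresentations
  can be subtracted from each other and composed with projections.\<close>

definition intertwines :: "('b \<Rightarrow> complex) set \<Rightarrow> (('b \<Rightarrow> complex) \<Rightarrow> 'b \<Rightarrow> complex) \<Rightarrow> bool" where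
  "intertwines U T \<longleftrightarrow> (\<forall>u\<in>U. T u \<in> V) \<and>
     (\<forall>u\<in>U. \<forall>u'\<in>U. T (u + u') = T u + T u') \<and>
     (\<forall>c. \<forall>u\<in>U. T (cscale c u) = cscale c (T u)) \<and>
     (\<forall>g\<in>carrier G. \<forall>u\<in>U. T (R g u) = R g (T u))"

lemma intertwinesD:
  assumes "intertwines U T"
  shows "u \<in> U \<Longrightarrow> T u \<in> V"
    and "\<lbrakk>u \<in> U; u' \<in> U\<rbrakk> \<Longrightarrow> T (u + u') = T u + T u'"
    and "u \<in> U \<Longrightarrow> T (cscale c u) = cscale c (T u)"
    and "\<lbrakk>g \<in> carrier G; u \<in> U\<rbrakk> \<Longrightarrow> T (R g u) = R g (T u)"
  using assms by (auto simp: intertwines_def)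

lemma intertwines_0:
  assumes "intertwines U T" "subspace U"
  shows "T 0 = 0"
  using intertwinesD(3)[OF assms(1) subspace_0[OF assms(2)], of 0] by simp

lemma intertwines_sum:
  assumes "intertwines U T" "subspace U" "\<And>i. i \<in> I \<Longrightarrow> x i \<in> U"
  shows "T (\<Sum>i\<in>I. x i) = (\<Sum>i\<in>I. T (x i))"
  using assms(3)
  by (induction I rule: infinite_finite_induct)
    (auto simp: intertwines_0[OF assms(1,2)] intertwinesD(2)[OF assms(1)] subspace_sum[OF assms(2)])

lemma intertwines_subset: "\<lbrakk>intertwines U T; W \<subseteq> U\<rbrakk> \<Longrightarrow> intertwines W T"
  unfolding intertwines_def by blast

lemma intertwines_comp:
  assumes "intertwines U T" "intertwines V T'"
  shows "intertwines U (\<lambda>u. T' (T u))"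
  using assms unfolding intertwines_def by simp

lemma intertwines_scale:
  assumes "intertwines U T"
  shows "intertwines U (\<lambda>u. cscale c (T u))"
  unfolding intertwines_def
  using intertwinesD[OF assms] subspace_scale[OF subspace_V] rep_scale
  by (auto simp: scale_right_distrib mult.commute)

lemma intertwines_diff:
  assumes "intertwines U T" "intertwines U T'"
  shows "intertwines U (\<lambda>u. T u - T' u)"
proof -
  have "R g (v - w) = R g v - R g w" if "g \<in> carrier G" "v \<in> V" "w \<in> V" for g v w
    by (auto simp: perm_rep_def fun_eq_iff)
  then show ?thesis
    unfolding intertwines_def
    using intertwinesD[OF assms(1)] intertwinesD[OF assms(2)] subspace_diff[OF subspace_V]
    by (simp add: scale_right_diff_distrib)
qed

text \<open>In each identity the right-hand side has the residual property that singles out the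
  projection; for equivariance this property is carried along by the unitary operator
  \<open>R g\<close>.\<close>

lemma intertwines_proj:
  assumes W: "subrep W"
  shows "intertwines V (proj E W)"
proof -
  note U = finite_E subrepD(1,2)[OF W]
  note in_W = proj_in[OF U] and orth = proj_orthogonal[OF U] and unique = proj_unique[OF U]
  have "proj E W (R g v) = R g (proj E W v)" if g: "g \<in> carrier G" and v: "v \<in> V" for g v
  proof (rule unique)
    show "R g (proj E W v) \<in> W"
      by (rule subrepD(3)[OF W g in_W])
    fix w assume w: "w \<in> W"
    have "R g v - R g (proj E W v) = R g (v - proj E W v)"
      by (auto simp: perm_rep_def fun_eq_iff)
    then show "ip E (R g v - R g (proj E W v)) w = 0"
      using ip_R_left[OF g, of w "v - proj E W v"] orth subrepD(2,3)[OF W] g w by auto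
  qed
  moreover have "proj E W (v + v') = proj E W v + proj E W v'" for v v'
  proof (rule unique)
    show "proj E W v + proj E W v' \<in> W"
      by (intro subspace_add in_W U(2))
    fix w assume "w \<in> W"
    then show "ip E (v + v' - (proj E W v + proj E W v')) w = 0"
      using orth[of w v] orth[of w v'] by (simp add: ip_simps algebra_simps)
  qed
  moreover have "proj E W (cscale c v) = cscale c (proj E W v)" for c v
  proof (rule unique)
    show "cscale c (proj E W v) \<in> W"
      by (intro subspace_scale in_W U(2))
    fix w assume "w \<in> W"
    then show "ip E (cscale c v - cscale c (proj E W v)) w = 0"
      using orth[of w v] by (simp add: ip_simps)
  qed
  ultimately show ?thesis
    using in_W U(3) by (auto simp: intertwines_def)
qed

text \<open>\<open>T* T\<close> has an eigenvector in \<open>U\<close>. Its eigenspace is a nonzero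
  subrepresentation, hence all of \<open>U\<close>, so \<open>T* T\<close> is a scalar. Nothing is
  asked of the image of \<open>T\<close>, and the scalar may be zero.\<close>

lemma schur_norm:
  assumes U: "irreducible_subrep U" and T: "intertwines U T"
  obtains a where "a \<ge> 0" "\<And>u. u \<in> U \<Longrightarrow> nsq E (T u) = a * nsq E u"
proof -
  note sub = subrepD[OF irreducibleD(1)[OF U]]
  note T_simps = intertwinesD[OF T]
  obtain B where B: "finite B" "B \<subseteq> U" "orthonormal E id B"
    "\<And>u. u \<in> U \<Longrightarrow> u = (\<Sum>b\<in>B. cscale (ip E u b) b)"
    using exists_orthonormal_basis[OF finite_E sub(1,2)] by metis
  \<comment> \<open>This is \<open>T* T\<close> as an operator on \<open>U\<close>, written in the
    basis \<open>B\<close>; \<open>M_adjoint\<close> is its defining property.\<close>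
  define M where "M u = (\<Sum>b\<in>B. cscale (ip E (T u) (T b)) b)" for u
  have M_adjoint: "ip E (M u) w = ip E (T u) (T w)" if "w \<in> U" for u w
  proof -
    have "T w = T (\<Sum>b\<in>B. cscale (ip E w b) b)"
      using B(4)[OF that] by simp
    also have "\<dots> = (\<Sum>b\<in>B. T (cscale (ip E w b) b))"
      by (rule intertwines_sum[OF T sub(1)]) (use B(2) subspace_scale[OF sub(1)] in blast)
    also have "\<dots> = (\<Sum>b\<in>B. cscale (ip E w b) (T b))"
      by (intro sum.cong refl T_simps(3)) (use B(2) in blast)
    finally show ?thesis
      by (simp add: M_def ip_simps ip_commute[of E w] mult.commute)
  qed
  have "U \<subseteq> span B"
  proof
    fix u assume "u \<in> U"
    show "u \<in> span B"
      by (subst B(4)[OF \<open>u \<in> U\<close>]) (intro span_sum span_scale span_base)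
  qed
  moreover have "M u \<in> U" for u
    unfolding M_def by (intro subspace_sum subspace_scale sub(1)) (use B(2) in blast)
  moreover have "M (u + w) = M u + M w" if "u \<in> U" "w \<in> U" for u w
    using that by (simp add: M_def T_simps(2) ip_simps scale_left_distrib sum.distrib)
  moreover have "M (cscale c u) = cscale c (M u)" if "u \<in> U" for c u
    using that by (simp add: M_def T_simps(3) ip_simps scale_sum_right)
  ultimately obtain a u where u: "u \<in> U" "u \<noteq> 0" "M u = cscale a u"
    using exists_eigenvector[OF cfun.vector_space_axioms sub(1) irreducibleD(2)[OF U] B(1), of M]
    by metis
  \<comment> \<open>The eigenspace of \<open>T* T\<close> for \<open>a\<close>, expressed by inner
    products so that its invariance follows from unitarity.\<close>
  define K where "K = {v \<in> U. \<forall>w\<in>U. ip E (T v) (T w) = a * ip E v w}"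
  have "subrep K"
    unfolding subrep_def
  proof (intro conjI ballI)
    show "subspace K"
      unfolding subspace_def
      by (auto simp: K_def T_simps intertwines_0[OF T sub(1)] ip_simps algebra_simps
          subspace_0[OF sub(1)] subspace_add[OF sub(1)] subspace_scale[OF sub(1)])
    show "K \<subseteq> V"
      using sub(2) by (auto simp: K_def)
    fix g v assume g: "g \<in> carrier G" and v: "v \<in> K"
    have "ip E (T (R g v)) (T w) = a * ip E (R g v) w" if w: "w \<in> U" for w
    proof -
      have "ip E (T (R g v)) (T w) = ip E (T v) (T (R (inv g) w))"
        using v g w T_simps(1,4) ip_R_left[OF g] by (simp add: K_def)
      also have "\<dots> = a * ip E v (R (inv g) w)"
        using v g w sub(3) by (simp add: K_def)
      also have "ip E v (R (inv g) w) = ip E (R g v) w"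
        using ip_R_left[OF g] w sub(2) by auto
      finally show ?thesis .
    qed
    then show "R g v \<in> K"
      using v g sub(3) by (simp add: K_def)
  qed
  moreover have "u \<in> K"
    using u M_adjoint[of _ u] by (simp add: K_def ip_simps)
  ultimately have "K = U"
    using irreducibleD(3)[OF U, of K] u(2) by (auto simp: K_def)
  have eq: "nsq E (T v) = Re a * nsq E v" if "v \<in> U" for v
  proof -
    have "ip E (T v) (T v) = a * ip E v v"
      using that \<open>K = U\<close> by (auto simp: K_def)
    then show ?thesis
      by (simp add: nsq_eq_Re) (simp add: ip_self)
  qed
  moreover have "Re a \<ge> 0"
  proof -
    have "nsq E u > 0"
      using u sub(2) by (intro nsq_pos finite_E) auto
    then show ?thesis
      using eq[OF u(1)] nsq_nonneg[of E "T u"] by (metis zero_le_mult_iff less_le_not_le)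
  qed
  ultimately show thesis
    using that by blast
qed

text \<open>\<open>T\<close> multiplies squared norms by a constant, nonzero because
  \<open>T u\<close> is, so \<open>T\<close> is injective. Its image is a nonzero subrepresentation
  of the irreducible \<open>U'\<close>.\<close>

lemma schur_bij:
  assumes U: "irreducible_subrep U" and U': "irreducible_subrep U'"
    and T: "intertwines U T" "T ` U \<subseteq> U'" and nz: "u \<in> U" "T u \<noteq> 0"
  shows "bij_betw T U U'"
proof -
  note sub = subrepD[OF irreducibleD(1)[OF U]]
  note T_simps = intertwinesD[OF T(1)]
  obtain a where a: "a \<ge> 0" "\<And>u. u \<in> U \<Longrightarrow> nsq E (T u) = a * nsq E u"
    using schur_norm[OF U T(1)] by metis
  have "a \<noteq> 0"
    using a(2)[OF nz(1)] nz T_simps(1) nsq_eq_0_iff[OF finite_E] by auto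
  have "inj_on T U"
  proof (rule inj_onI)
    fix v w assume vw: "v \<in> U" "w \<in> U" "T v = T w"
    have diff: "v - w \<in> U"
      by (rule subspace_diff[OF sub(1) vw(1,2)])
    have "T v = T (v - w) + T w"
      using T_simps(2)[OF diff vw(2)] by simp
    then have "T (v - w) = 0"
      using vw(3) by simp
    then have "nsq E (v - w) = 0"
      using a(2)[OF diff] \<open>a \<noteq> 0\<close> by (simp add: nsq_def)
    then show "v = w"
      using diff sub(2) nsq_eq_0_iff[OF finite_E, of "v - w"] by auto
  qed
  moreover have "subrep (T ` U)"
    unfolding subrep_def
  proof (intro conjI ballI)
    show "subspace (T ` U)"
      unfolding subspace_def
    proof (intro conjI ballI allI)
      show "0 \<in> T ` U"
        using intertwines_0[OF T(1) sub(1)] subspace_0[OF sub(1)] by (metis imageI)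
    next
      fix x y assume "x \<in> T ` U" "y \<in> T ` U"
      then show "x + y \<in> T ` U"
        using T_simps(2) subspace_add[OF sub(1)] by (metis (no_types, lifting) imageE imageI)
    next
      fix c x assume "x \<in> T ` U"
      then show "cscale c x \<in> T ` U"
        using T_simps(3) subspace_scale[OF sub(1)] by (metis (no_types, lifting) imageE imageI)
    qed
    show "T ` U \<subseteq> V"
      using T_simps(1) by blast
    show "R g x \<in> T ` U" if "g \<in> carrier G" "x \<in> T ` U" for g x
      using that T_simps(4) sub(3) by (metis (no_types, lifting) imageE imageI)
  qed
  then have "T ` U = U'"
    using irreducibleD(3)[OF U' _ T(2)] nz by blast
  ultimately show ?thesis
    by (simp add: bij_betw_def)
qed

lemma subrep_isoI:
  assumes "intertwines U T" "bij_betw T U U'"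
  shows "subrep_iso U U'"
  using assms unfolding subrep_iso_def intertwines_def by blast

text \<open>Multiplicities count isomorphisms from a summand onto \<open>U\<close>, whereas the
  copies of \<open>U\<close> are built from maps out of \<open>U\<close>.\<close>

lemma subrep_iso_inverse:
  assumes "subrep_iso U' U" "subrep U" "subrep U'"
  obtains T where "intertwines U T" "bij_betw T U U'"
proof -
  note sub = subrepD[OF assms(3)]
  obtain T where T: "bij_betw T U' U"
    and hom: "\<And>u v. \<lbrakk>u \<in> U'; v \<in> U'\<rbrakk> \<Longrightarrow> T (u + v) = T u + T v"
      "\<And>c u. u \<in> U' \<Longrightarrow> T (cscale c u) = cscale c (T u)"
      "\<And>g u. \<lbrakk>g \<in> carrier G; u \<in> U'\<rbrakk> \<Longrightarrow> T (R g u) = R g (T u)"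
    using assms(1) unfolding subrep_iso_def by blast
  define T' where "T' = inv_into U' T"
  have bij: "bij_betw T' U U'"
    unfolding T'_def by (rule bij_betw_inv_into[OF T])
  have in_U': "T' u \<in> U'" and T_T': "T (T' u) = u" if "u \<in> U" for u
    using that bij T by (auto simp: T'_def bij_betw_def f_inv_into_f inv_into_into)
  have T'_T: "T' u = v" if "v \<in> U'" "T v = u" for u v
    using that T by (auto simp: T'_def bij_betw_def inv_into_f_f)
  have "intertwines U T'"
    unfolding intertwines_def
  proof (intro conjI ballI allI)
    fix u assume "u \<in> U"
    then show "T' u \<in> V"
      using in_U' sub(2) by blast
  next
    fix u v assume "u \<in> U" "v \<in> U"
    then show "T' (u + v) = T' u + T' v"
      by (intro T'_T) (simp_all add: hom in_U' T_T' subspace_add[OF sub(1)])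
  next
    fix c u assume "u \<in> U"
    then show "T' (cscale c u) = cscale c (T' u)"
      by (intro T'_T) (simp_all add: hom in_U' T_T' subspace_scale[OF sub(1)])
  next
    fix g u assume "g \<in> carrier G" "u \<in> U"
    then show "T' (R g u) = R g (T' u)"
      by (intro T'_T) (simp_all add: hom in_U' T_T' sub(3))
  qed
  with bij show thesis
    using that by blast
qed

section \<open>Orthogonal copies of an irreducible subrepresentation\<close>

definition subrep_sum :: "('b \<Rightarrow> complex) set set \<Rightarrow> ('b \<Rightarrow> complex) set" where
  "subrep_sum F = {\<Sum>U\<in>F. x U | x. x \<in> (\<Pi> U\<in>F. U)}"

lemma subrep_subrep_sum:
  assumes F: "\<And>U. U \<in> F \<Longrightarrow> subrep U"
  shows "subrep (subrep_sum F)"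
  unfolding subrep_def
proof (intro conjI ballI)
  note sub = subrepD[OF F]
  have sumI: "(\<Sum>U\<in>F. x U) \<in> subrep_sum F" if "\<And>U. U \<in> F \<Longrightarrow> x U \<in> U" for x
    using that by (auto simp: subrep_sum_def)
  have mem: "x U \<in> U" if "U \<in> F" "x \<in> (\<Pi> U\<in>F. U)" for x U
    using that by blast
  show "subspace (subrep_sum F)"
    unfolding subspace_def
  proof (intro conjI ballI allI)
    show "0 \<in> subrep_sum F"
      using sumI[of "\<lambda>_. 0"] subspace_0[OF sub(1)] by simp
  next
    fix v w assume "v \<in> subrep_sum F" "w \<in> subrep_sum F"
    then obtain x y where "v = (\<Sum>U\<in>F. x U)" "x \<in> (\<Pi> U\<in>F. U)" "w = (\<Sum>U\<in>F. y U)" "y \<in> (\<Pi> U\<in>F. U)"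
      by (auto simp: subrep_sum_def)
    moreover from this have "(\<Sum>U\<in>F. x U + y U) \<in> subrep_sum F"
      by (intro sumI subspace_add sub(1) mem)
    ultimately show "v + w \<in> subrep_sum F"
      by (simp add: sum.distrib)
  next
    fix c v assume "v \<in> subrep_sum F"
    then obtain x where "v = (\<Sum>U\<in>F. x U)" "x \<in> (\<Pi> U\<in>F. U)"
      by (auto simp: subrep_sum_def)
    moreover from this have "(\<Sum>U\<in>F. cscale c (x U)) \<in> subrep_sum F"
      by (intro sumI subspace_scale sub(1) mem)
    ultimately show "cscale c v \<in> subrep_sum F"
      by (simp add: scale_sum_right)
  qed
  show "subrep_sum F \<subseteq> V"
    using sub(2) by (fastforce simp: subrep_sum_def intro!: subspace_sum[OF subspace_V])
  fix g v assume g: "g \<in> carrier G" and "v \<in> subrep_sum F"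
  then obtain x where "v = (\<Sum>U\<in>F. x U)" "x \<in> (\<Pi> U\<in>F. U)"
    by (auto simp: subrep_sum_def)
  moreover have "R g (\<Sum>U\<in>F. x U) = (\<Sum>U\<in>F. R g (x U))"
    by (rule ext) (simp add: perm_rep_def sum_fun_apply)
  moreover from calculation have "(\<Sum>U\<in>F. R g (x U)) \<in> subrep_sum F"
    by (intro sumI sub(3) g mem)
  ultimately show "R g v \<in> subrep_sum F"
    by simp
qed

text \<open>Directness of the sum, tested at zero only. In this form it passes to subfamilies on
  extending a choice of vectors by zero.\<close>

definition independent_family :: "('b \<Rightarrow> complex) set set \<Rightarrow> bool" where
  "independent_family F \<longleftrightarrow> (\<forall>x\<in>(\<Pi> W\<in>F. W). (\<Sum>W\<in>F. x W) = 0 \<longrightarrow> (\<forall>W\<in>F. x W = 0))"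

lemma independent_familyD:
  assumes "independent_family F" "x \<in> (\<Pi> W\<in>F. W)" "(\<Sum>W\<in>F. x W) = 0" "W \<in> F"
  shows "x W = 0"
  by (rule assms(1)[unfolded independent_family_def, rule_format, OF assms(2-4)])

definition orthogonal_embeddings ::
  "('b \<Rightarrow> complex) set \<Rightarrow> ('i \<Rightarrow> ('b \<Rightarrow> complex) \<Rightarrow> 'b \<Rightarrow> complex) \<Rightarrow> 'i set \<Rightarrow> bool" where
  "orthogonal_embeddings U T F \<longleftrightarrow>
    (\<forall>i\<in>F. intertwines U (T i) \<and> (\<forall>u\<in>U. nsq E (T i u) = nsq E u)) \<and>
    (\<forall>i\<in>F. \<forall>j\<in>F. i \<noteq> j \<longrightarrow> (\<forall>u\<in>U. \<forall>w\<in>U. ip E (T i u) (T j w) = 0))"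

lemma orthogonal_embeddingsD:
  assumes "orthogonal_embeddings U T F"
  shows "i \<in> F \<Longrightarrow> intertwines U (T i)"
    and "\<lbrakk>i \<in> F; u \<in> U\<rbrakk> \<Longrightarrow> nsq E (T i u) = nsq E u"
    and "\<lbrakk>i \<in> F; j \<in> F; i \<noteq> j; u \<in> U; w \<in> U\<rbrakk> \<Longrightarrow> ip E (T i u) (T j w) = 0"
  using assms by (auto simp: orthogonal_embeddings_def)

text \<open>Gram-Schmidt with subrepresentations in place of vectors. A new copy of \<open>U\<close>
  is an isomorphism \<open>T0\<close> minus its projection to the sum \<open>S\<close> of the
  previous summands, rescaled to an isometry. The clause on images places the earlier copies inside
  \<open>S\<close>, to which the new one is orthogonal.\<close>

lemma exists_orthogonal_embeddings:
  assumes U: "irreducible_subrep U" and "finite F"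
    and F: "\<And>W. W \<in> F \<Longrightarrow> irreducible_subrep W \<and> subrep_iso W U"
    and indep: "independent_family F"
  shows "\<exists>T. orthogonal_embeddings U T F \<and> (\<forall>W\<in>F. T W ` U \<subseteq> subrep_sum F)"
  using \<open>finite F\<close> F indep
proof (induction F rule: finite_induct)
  case (insert W F)
  have "independent_family F"
    unfolding independent_family_def
  proof (intro ballI impI)
    fix x X assume x: "x \<in> (\<Pi> X\<in>F. X)" "(\<Sum>X\<in>F. x X) = 0" "X \<in> F"
    define y where "y = x(W := 0)"
    have "0 \<in> W"
      using insert.prems(1)[of W] irreducibleD(1) subrepD(1) subspace_0 by blast
    then have "y \<in> (\<Pi> X\<in>insert W F. X)"
      using x(1) by (auto simp: y_def)
    moreover have "(\<Sum>X\<in>F. y X) = (\<Sum>X\<in>F. x X)"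
      by (rule sum.cong) (use insert.hyps in \<open>auto simp: y_def\<close>)
    then have "(\<Sum>X\<in>insert W F. y X) = 0"
      using insert.hyps x(2) by (simp add: y_def)
    ultimately have "y X = 0"
      using independent_familyD[OF insert.prems(2), of y X] x(3) by blast
    then show "x X = 0"
      using x(3) insert.hyps by (auto simp: y_def split: if_splits)
  qed
  then obtain T where T_emb: "orthogonal_embeddings U T F"
    and T_in: "\<And>X u. \<lbrakk>X \<in> F; u \<in> U\<rbrakk> \<Longrightarrow> T X u \<in> subrep_sum F"
    using insert.IH[OF insert.prems(1)] by blast
  note T = orthogonal_embeddingsD[OF T_emb]
  have W: "irreducible_subrep W" "subrep_iso W U"
    using insert.prems(1) by simp_all
  note subW = subrepD[OF irreducibleD(1)[OF W(1)]]
  note subU = subrepD[OF irreducibleD(1)[OF U]]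
  define S where "S = subrep_sum F"
  have S: "subrep S"
    unfolding S_def using insert.prems(1) irreducibleD(1) by (intro subrep_subrep_sum) blast
  note projS = proj_in[OF finite_E subrepD(1,2)[OF S]] proj_orthogonal[OF finite_E subrepD(1,2)[OF S]]
  obtain T0 where T0: "intertwines U T0" "bij_betw T0 U W"
    using subrep_iso_inverse[OF W(2) irreducibleD(1)[OF U] irreducibleD(1)[OF W(1)]] by metis
  have T0_in: "T0 u \<in> W" if "u \<in> U" for u
    using that T0(2) by (auto simp: bij_betw_def)
  define T1 where "T1 u = T0 u - proj E S (T0 u)" for u
  have T1: "intertwines U T1"
    unfolding T1_def by (intro intertwines_diff intertwines_comp[OF T0(1) intertwines_proj[OF S]] T0(1))
  obtain a where a: "a \<ge> 0" "\<And>u. u \<in> U \<Longrightarrow> nsq E (T1 u) = a * nsq E u"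
    using schur_norm[OF U T1] by metis
  \<comment> \<open>If \<open>a\<close> were zero, \<open>T0 u\<close> would equal its projection
    and lie in \<open>S\<close>, although it is a nonzero vector of \<open>W\<close>.\<close>
  have "a \<noteq> 0"
  proof
    assume "a = 0"
    obtain u where u: "u \<in> U" "u \<noteq> 0"
      using irreducibleD(2)[OF U] subspace_0[OF subU(1)] by blast
    have "nsq E (T1 u) = 0"
      using a(2)[OF u(1)] \<open>a = 0\<close> by simp
    then have "T1 u = 0"
      using nsq_eq_0_iff[OF finite_E] intertwinesD(1)[OF T1 u(1)] by blast
    then have "T0 u \<in> S"
      using projS(1)[of "T0 u"] by (simp add: T1_def)
    then obtain x where x: "T0 u = (\<Sum>X\<in>F. x X)" "x \<in> (\<Pi> X\<in>F. X)"
      by (auto simp: S_def subrep_sum_def)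
    \<comment> \<open>The expansion of \<open>T0 u\<close> over \<open>F\<close> becomes a vanishing
      sum over \<open>insert W F\<close> with entry \<open>- T0 u\<close> at
      \<open>W\<close>.\<close>
    define y where "y = x(W := - T0 u)"
    have "y \<in> (\<Pi> X\<in>insert W F. X)"
      using x(2) subspace_neg[OF subW(1) T0_in[OF u(1)]] by (auto simp: y_def)
    moreover have "(\<Sum>X\<in>F. y X) = (\<Sum>X\<in>F. x X)"
      by (rule sum.cong) (use insert.hyps in \<open>auto simp: y_def\<close>)
    then have "(\<Sum>X\<in>insert W F. y X) = 0"
      using insert.hyps x(1) by (simp add: y_def)
    ultimately have "y W = 0"
      using independent_familyD[OF insert.prems(2), of y W] by blast
    then have "T0 u = T0 0"
      by (simp add: y_def intertwines_0[OF T0(1) subU(1)])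
    then show False
      using u T0(2) subspace_0[OF subU(1)] by (auto simp: bij_betw_def inj_on_def)
  qed
  with a(1) have "a > 0"
    by simp
  \<comment> \<open>\<open>T1\<close> multiplies squared norms by \<open>a\<close>.\<close>
  define T2 where "T2 u = cscale (1 / sqrt a) (T1 u)" for u
  have T2: "intertwines U T2"
    unfolding T2_def by (rule intertwines_scale[OF T1])
  have T2_nsq: "nsq E (T2 u) = nsq E u" if "u \<in> U" for u
    using a(2)[OF that] \<open>a > 0\<close> by (simp add: T2_def nsq_scale norm_divide power_divide)
  have T2_orth: "ip E (T2 u) s = 0" "ip E s (T2 u) = 0" if "s \<in> S" for u s
    using projS(2)[OF that, of "T0 u"] ip_eq_0_commute[of E s "T1 u"]
    by (simp_all add: T2_def T1_def ip_scale_left ip_scale_right)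
  have S_insert: "w + s \<in> subrep_sum (insert W F)" if w: "w \<in> W" and s: "s \<in> S" for w s
  proof -
    obtain x where x: "s = (\<Sum>X\<in>F. x X)" "x \<in> (\<Pi> X\<in>F. X)"
      using s by (auto simp: S_def subrep_sum_def)
    define y where "y = x(W := w)"
    have "y \<in> (\<Pi> X\<in>insert W F. X)"
      using x(2) w by (auto simp: y_def)
    moreover have "(\<Sum>X\<in>F. y X) = (\<Sum>X\<in>F. x X)"
      by (rule sum.cong) (use insert.hyps in \<open>auto simp: y_def\<close>)
    then have "w + s = (\<Sum>X\<in>insert W F. y X)"
      using insert.hyps x(1) by (simp add: y_def)
    ultimately show ?thesis
      unfolding subrep_sum_def by blast
  qed
  have T2_in: "T2 u \<in> subrep_sum (insert W F)" if "u \<in> U" for u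
  proof -
    have "T2 u = cscale (1 / sqrt a) (T0 u) + cscale (- (1 / sqrt a)) (proj E S (T0 u))"
      by (simp add: T2_def T1_def scale_right_diff_distrib)
    then show ?thesis
      using S_insert[OF subspace_scale[OF subW(1) T0_in[OF that]]
          subspace_scale[OF subrepD(1)[OF S] projS(1)]] by presburger
  qed
  define T' where "T' = T(W := T2)"
  have T'_W: "T' W = T2" and T'_F: "\<And>X. X \<in> F \<Longrightarrow> T' X = T X"
    using insert.hyps by (auto simp: T'_def)
  have T_in': "T X u \<in> subrep_sum (insert W F)" if "X \<in> F" "u \<in> U" for X u
    using S_insert[OF subspace_0[OF subW(1)], of "T X u"] T_in[OF that] by (simp add: S_def)
  have "orthogonal_embeddings U T' (insert W F)"
    unfolding orthogonal_embeddings_def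
  proof (intro conjI ballI impI)
    fix X assume "X \<in> insert W F"
    then show "intertwines U (T' X)"
      using T2 T(1) T'_W T'_F by auto
    fix u assume "u \<in> U"
    with \<open>X \<in> insert W F\<close> show "nsq E (T' X u) = nsq E u"
      using T2_nsq T(2) T'_W T'_F by auto
  next
    fix X X' u w
    assume "X \<in> insert W F" "X' \<in> insert W F" "X \<noteq> X'" "u \<in> U" "w \<in> U"
    then show "ip E (T' X u) (T' X' w) = 0"
      by (elim insertE) (simp_all add: T'_W T'_F T(3) T_in T2_orth S_def)
  qed
  moreover have "T' X ` U \<subseteq> subrep_sum (insert W F)" if "X \<in> insert W F" for X
    using that T2_in T_in' T'_W T'_F by auto
  ultimately show ?case
    by blast
qed (simp add: orthogonal_embeddings_def)

text \<open>The zero vector has a unique expansion over \<open>D\<close>. The extension of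
  \<open>x\<close> by zero and the zero family are both such expansions; they are restricted to
  \<open>D\<close> because uniqueness concerns extensional functions.\<close>

lemma decomposition_independent:
  assumes D: "irreducible_decomposition D" and F: "F \<subseteq> D"
  shows "independent_family F"
  unfolding independent_family_def
proof (intro ballI impI)
  fix x W assume x: "x \<in> (\<Pi> W\<in>F. W)" "(\<Sum>W\<in>F. x W) = 0" "W \<in> F"
  define y where "y = (\<lambda>W\<in>D. if W \<in> F then x W else 0)"
  define z where "z = (\<lambda>W\<in>D. 0 :: 'b \<Rightarrow> complex)"
  have zero: "0 \<in> W" if "W \<in> D" for W
  proof -
    have "irreducible_subrep W"
      using D that by (simp add: irreducible_decomposition_def)
    then show ?thesis
      by (intro subspace_0 subrepD(1) irreducibleD(1))
  qed
  have "finite D"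
    using D by (simp add: irreducible_decomposition_def)
  have "(\<Sum>W\<in>D. y W) = (\<Sum>W\<in>F. x W)"
    by (rule sum.mono_neutral_cong_right) (use \<open>finite D\<close> F in \<open>auto simp: y_def\<close>)
  then have y: "y \<in> (\<Pi>\<^sub>E W\<in>D. W) \<and> 0 = (\<Sum>W\<in>D. y W)"
    using x zero by (auto simp: y_def)
  have z: "z \<in> (\<Pi>\<^sub>E W\<in>D. W) \<and> 0 = (\<Sum>W\<in>D. z W)"
    using zero by (auto simp: z_def)
  have "\<forall>v\<in>V. \<exists>!x. x \<in> (\<Pi>\<^sub>E W\<in>D. W) \<and> v = (\<Sum>W\<in>D. x W)"
    using D unfolding irreducible_decomposition_def by (elim conjE)
  then have "\<exists>!x. x \<in> (\<Pi>\<^sub>E W\<in>D. W) \<and> 0 = (\<Sum>W\<in>D. x W)"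
    using subspace_0[OF subspace_V] by (rule bspec)
  then have "\<exists>\<^sub>\<le>\<^sub>1x. x \<in> (\<Pi>\<^sub>E W\<in>D. W) \<and> 0 = (\<Sum>W\<in>D. x W)"
    unfolding ex1_iff_ex_Uniq by (rule conjunct2)
  from this y z have "y = z"
    by (rule Uniq_D[of "\<lambda>x. x \<in> (\<Pi>\<^sub>E W\<in>D. W) \<and> 0 = (\<Sum>W\<in>D. x W)"])
  then have "y W = z W"
    by (rule arg_cong)
  then show "x W = 0"
    using x(3) F by (auto simp: y_def z_def)
qed

section \<open>The convolution operator\<close>

text \<open>Writing the convolution by the characteristic function of \<open>S\<close> as a sum of
  operators \<open>R s\<close> makes it evident that it preserves subrepresentations and commutes
  with intertwining maps.\<close>

definition conv :: "'g set \<Rightarrow> ('b \<Rightarrow> complex) \<Rightarrow> 'b \<Rightarrow> complex" where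
  "conv S v = (\<Sum>s\<in>S. R s v)"

lemma conv_0: "conv S 0 = 0"
proof -
  have "R s 0 = 0" for s
    by (auto simp: perm_rep_def fun_eq_iff)
  then show ?thesis
    by (simp add: conv_def)
qed

lemma conv_closed:
  assumes "subrep U" "S \<subseteq> carrier G" "u \<in> U"
  shows "conv S u \<in> U"
  unfolding conv_def using assms subrepD[OF assms(1)] by (intro subspace_sum) auto

lemma conv_intertwines:
  assumes "intertwines U T" "subrep U" "S \<subseteq> carrier G" "u \<in> U"
  shows "T (conv S u) = conv S (T u)"
proof -
  have "T (conv S u) = (\<Sum>s\<in>S. T (R s u))"
    unfolding conv_def
    by (rule intertwines_sum[OF assms(1) subrepD(1)[OF assms(2)]])
      (use assms subrepD(3)[OF assms(2)] in blast)
  also have "\<dots> = conv S (T u)"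
    unfolding conv_def using assms intertwinesD(4)[OF assms(1)] by (intro sum.cong) auto
  finally show ?thesis .
qed

lemma action_eq_iff:
  assumes "s \<in> carrier G" "x \<in> E" "y \<in> E"
  shows "\<phi> s y = x \<longleftrightarrow> y = \<phi> (inv s) x"
  using assms orbit_sym_aux[of s y x] orbit_sym_aux[of "inv s" x y] by auto

text \<open>This exhibits the matrix to which the Hilbert-Schmidt bound is applied. For each
  \<open>s\<close> exactly one \<open>y\<close> satisfies \<open>\<phi> s y = x\<close>, and
  exchanging the sums counts the \<open>s\<close> for each \<open>y\<close>.\<close>

lemma conv_apply:
  assumes S: "finite S" "S \<subseteq> carrier G" and x: "x \<in> E"
  shows "conv S v x = (\<Sum>y\<in>E. of_nat (card {s \<in> S. \<phi> s y = x}) * v y)"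
proof -
  have "conv S v x = (\<Sum>s\<in>S. \<Sum>y\<in>E. if \<phi> s y = x then v y else 0)"
  proof -
    have "R s v x = (\<Sum>y\<in>E. if \<phi> s y = x then v y else 0)" if "s \<in> S" for s
    proof -
      have s: "s \<in> carrier G"
        using that S by blast
      have "(\<Sum>y\<in>E. if \<phi> s y = x then v y else 0) = (\<Sum>y\<in>E. if y = \<phi> (inv s) x then v y else 0)"
        by (intro sum.cong) (auto simp: action_eq_iff[OF s x])
      also have "\<dots> = R s v x"
        using x s finite_E element_image[of "inv s" x] by (auto simp: perm_rep_def)
      finally show ?thesis
        by simp
    qed
    then show ?thesis
      by (simp add: conv_def sum_fun_apply)
  qed
  also have "\<dots> = (\<Sum>y\<in>E. \<Sum>s\<in>S. if \<phi> s y = x then v y else 0)"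
    by (rule sum.swap)
  also have "\<dots> = (\<Sum>y\<in>E. of_nat (card {s \<in> S. \<phi> s y = x}) * v y)"
    by (intro sum.cong refl) (simp add: sum.If_cases S(1) Int_def)
  finally show ?thesis .
qed

text \<open>Each \<open>s\<close> sends \<open>y\<close> to exactly one point, so the fibres over
  \<open>x\<close> partition \<open>S\<close>.\<close>

lemma sum_card_transporter:
  assumes "finite S" "S \<subseteq> carrier G" "y \<in> E"
  shows "(\<Sum>x\<in>E. card {s \<in> S. \<phi> s y = x}) = card S"
proof -
  have "(\<Sum>x\<in>E. card {s \<in> S. \<phi> s y = x}) = (\<Sum>x\<in>E. \<Sum>s\<in>S. if \<phi> s y = x then 1 else 0)"
    by (simp add: sum.If_cases assms(1) Int_def)
  also have "\<dots> = (\<Sum>s\<in>S. \<Sum>x\<in>E. if \<phi> s y = x then 1 else 0)"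
    by (rule sum.swap)
  also have "\<dots> = (\<Sum>s\<in>S. 1)"
    using assms finite_E element_image by (intro sum.cong) auto
  finally show ?thesis
    by simp
qed

text \<open>For a unit vector \<open>u\<close> of \<open>U\<close> the vectors \<open>T W u\<close>
  are orthonormal, which bounds their number. Since \<open>T W\<close> is isometric and commutes
  with \<open>conv S\<close>, the operator \<open>conv S\<close> gives all of them the same norm as
  \<open>u\<close>, and the Hilbert-Schmidt bound applies to the family.\<close>

lemma copies_bound:
  assumes U: "irreducible_subrep U" and D: "irreducible_decomposition D"
  defines "k \<equiv> card {W \<in> D. subrep_iso W U}"
  shows "k \<le> card E"
    and "\<lbrakk>finite S; S \<subseteq> carrier G; v \<in> U\<rbrakk> \<Longrightarrow>
      real k * nsq E (conv S v) \<le> (\<Sum>x\<in>E. \<Sum>y\<in>E. (real (card {s \<in> S. \<phi> s y = x}))\<^sup>2) * nsq E v"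
proof -
  define F where "F = {W \<in> D. subrep_iso W U}"
  note sub = subrepD[OF irreducibleD(1)[OF U]]
  have "finite F" "F \<subseteq> D" and F: "\<And>W. W \<in> F \<Longrightarrow> irreducible_subrep W \<and> subrep_iso W U"
    using D by (auto simp: F_def irreducible_decomposition_def)
  obtain T where T_emb: "orthogonal_embeddings U T F"
    using exists_orthogonal_embeddings[OF U \<open>finite F\<close> F decomposition_independent[OF D \<open>F \<subseteq> D\<close>]]
    by metis
  note T = orthogonal_embeddingsD[OF T_emb]
  have orth: "orthonormal E (\<lambda>W. T W u) F" if "u \<in> U" "nsq E u = 1" for u
    using T that by (auto simp: orthonormal_def ip_self)
  obtain u where "u \<in> U" "nsq E u = 1"
    by (rule exists_unit_vector[OF irreducibleD(1,2)[OF U]])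
  then show "k \<le> card E"
    using card_orthonormal_le[OF orth \<open>finite F\<close> finite_E] by (simp add: k_def F_def)
  assume S: "finite S" "S \<subseteq> carrier G" and v: "v \<in> U"
  let ?C = "\<Sum>x\<in>E. \<Sum>y\<in>E. (real (card {s \<in> S. \<phi> s y = x}))\<^sup>2"
  show "real k * nsq E (conv S v) \<le> ?C * nsq E v"
  proof (cases "v = 0")
    case True
    then show ?thesis
      by (simp add: conv_0 nsq_def)
  next
    case False
    then obtain c where c: "c \<noteq> 0" "nsq E (cscale c v) = 1"
      using exists_normalization[OF finite_E] v sub(2) by blast
    \<comment> \<open>Both sides of the claim are quadratic in \<open>v\<close>, so a unit vector
      suffices.\<close>
    define u where "u = cscale c v"
    have u: "u \<in> U" "nsq E u = 1"
      using c v subspace_scale[OF sub(1)] by (auto simp: u_def)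
    have conv_u: "conv S u = cscale c (conv S v)"
      unfolding u_def conv_def scale_sum_right
      using S(2) sub(2) v by (intro sum.cong refl rep_scale) auto
    have "real k * nsq E (conv S u) = (\<Sum>W\<in>F. nsq E (T W (conv S u)))"
      using T(2) conv_closed[OF irreducibleD(1)[OF U] S(2) u(1)] by (simp add: k_def F_def)
    also have "\<dots> = (\<Sum>W\<in>F. nsq E (conv S (T W u)))"
      using conv_intertwines[OF T(1) irreducibleD(1)[OF U] S(2) u(1)] by simp
    also have "\<dots> \<le> (\<Sum>x\<in>E. \<Sum>y\<in>E. (cmod (of_nat (card {s \<in> S. \<phi> s y = x})))\<^sup>2)"
      by (rule sum_nsq_orthonormal_le[OF orth[OF u] \<open>finite F\<close>]) (rule conv_apply[OF S])
    finally have bound: "real k * nsq E (conv S u) \<le> ?C"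
      by simp
    have "(cmod c)\<^sup>2 * (real k * nsq E (conv S v)) = real k * nsq E (conv S u)"
      by (simp only: conv_u nsq_scale mult.left_commute)
    also note bound
    also have "?C = ?C * nsq E (cscale c v)"
      by (simp only: c(2) mult_1_right)
    also have "\<dots> = (cmod c)\<^sup>2 * (?C * nsq E v)"
      by (simp only: nsq_scale mult.left_commute)
    finally have "(cmod c)\<^sup>2 * (real k * nsq E (conv S v)) \<le> (cmod c)\<^sup>2 * (?C * nsq E v)" .
    then show ?thesis
      using c(1) by simp
  qed
qed

section \<open>Orthogonal decompositions and multiplicities\<close>

text \<open>The members are nonzero so that each supplies a unit vector, which bounds the size of
  the family.\<close>

definition orthogonal_family :: "('b \<Rightarrow> complex) set set \<Rightarrow> bool" where
  "orthogonal_family D \<longleftrightarrow> finite D \<and> (\<forall>U\<in>D. subrep U \<and> U \<noteq> {0}) \<and>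
     (\<forall>U\<in>D. \<forall>W\<in>D. U \<noteq> W \<longrightarrow> (\<forall>u\<in>U. \<forall>w\<in>W. ip E u w = 0))"

lemma orthogonal_familyD:
  assumes "orthogonal_family D"
  shows "finite D" "\<And>U. U \<in> D \<Longrightarrow> subrep U" "\<And>U. U \<in> D \<Longrightarrow> U \<noteq> {0}"
    "\<And>U W u w. \<lbrakk>U \<in> D; W \<in> D; U \<noteq> W; u \<in> U; w \<in> W\<rbrakk> \<Longrightarrow> ip E u w = 0"
  using assms unfolding orthogonal_family_def by (elim conjE, metis)+

lemma card_orthogonal_family_le:
  assumes "orthogonal_family D"
  shows "card D \<le> card E"
proof -
  note D = orthogonal_familyD[OF assms]
  have "\<forall>U\<in>D. \<exists>u. u \<in> U \<and> nsq E u = 1"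
  proof
    fix U assume U: "U \<in> D"
    obtain u where "u \<in> U" "nsq E u = 1"
      by (rule exists_unit_vector[OF D(2,3)[OF U]])
    then show "\<exists>u. u \<in> U \<and> nsq E u = 1"
      by blast
  qed
  then obtain e where e: "\<And>U. U \<in> D \<Longrightarrow> e U \<in> U" "\<And>U. U \<in> D \<Longrightarrow> nsq E (e U) = 1"
    by metis
  have "orthonormal E e D"
    unfolding orthonormal_def
  proof (intro ballI)
    fix U W assume "U \<in> D" "W \<in> D"
    then show "ip E (e U) (e W) = of_bool (U = W)"
      using D(4) e by (cases "U = W") (simp_all add: ip_self)
  qed
  then show ?thesis
    using D(1) finite_E by (rule card_orthonormal_le)
qed

text \<open>\<open>X\<close> is a new member, since otherwise a unit vector of \<open>X\<close>
  would be orthogonal to itself. Hence the insertion really increases the cardinality, as the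
  maximality argument requires.\<close>

lemma orthogonal_family_insert:
  assumes D: "orthogonal_family D" and X: "subrep X" "X \<noteq> {0}"
    and orth: "\<And>U u x. \<lbrakk>U \<in> D; u \<in> U; x \<in> X\<rbrakk> \<Longrightarrow> ip E u x = 0"
  shows "orthogonal_family (insert X D)" "X \<notin> D"
proof -
  have orth': "ip E x u = 0" if "U \<in> D" "u \<in> U" "x \<in> X" for U u x
    using orth[OF that] ip_eq_0_commute[of E x u] by simp
  show "orthogonal_family (insert X D)"
    unfolding orthogonal_family_def
  proof (intro conjI ballI impI)
    show "finite (insert X D)"
      using orthogonal_familyD(1)[OF D] by simp
    show "subrep U" "U \<noteq> {0}" if "U \<in> insert X D" for U
      using that X orthogonal_familyD(2,3)[OF D] by auto
    fix U W u w
    assume "U \<in> insert X D" "W \<in> insert X D" "U \<noteq> W" "u \<in> U" "w \<in> W"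
    then show "ip E u w = 0"
      using orthogonal_familyD(4)[OF D, of U W u w] orth[of U u w] orth'[of W w u] by blast
  qed
  show "X \<notin> D"
  proof
    assume "X \<in> D"
    obtain x where "x \<in> X" "nsq E x = 1"
      by (rule exists_unit_vector[OF X])
    then show False
      using orth[OF \<open>X \<in> D\<close>, of x x] by (simp add: ip_self)
  qed
qed

lemma orthogonal_family_subset:
  assumes "orthogonal_family D" "D' \<subseteq> D"
  shows "orthogonal_family D'"
  unfolding orthogonal_family_def
proof (intro conjI ballI impI)
  show "finite D'"
    using assms(2) orthogonal_familyD(1)[OF assms(1)] by (rule finite_subset)
  show "subrep U" "U \<noteq> {0}" if "U \<in> D'" for U
    using that assms(2) orthogonal_familyD(2,3)[OF assms(1)] by blast+
  show "ip E u w = 0" if "U \<in> D'" "W \<in> D'" "U \<noteq> W" "u \<in> U" "w \<in> W" for U W u w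
    using that assms(2) by (intro orthogonal_familyD(4)[OF assms(1), of U W]) auto
qed

text \<open>Completeness is stated as triviality of the orthogonal complement, the form in which
  maximality yields it; \<open>sum_proj\<close> turns it into an expansion.\<close>

definition orthogonal_decomposition :: "('b \<Rightarrow> complex) set set \<Rightarrow> bool" where
  "orthogonal_decomposition D \<longleftrightarrow> orthogonal_family D \<and> (\<forall>U\<in>D. irreducible_subrep U) \<and>
     (\<forall>v\<in>V. (\<forall>U\<in>D. \<forall>u\<in>U. ip E v u = 0) \<longrightarrow> v = 0)"

text \<open>An orthogonal family with as many members as possible consists of irreducible
  subrepresentations, as a reducible one could be split in two, and it leaves no room for a nonzero
  orthogonal complement.\<close>

lemma exists_orthogonal_decomposition: "\<exists>D. orthogonal_decomposition D"
proof -
  have "\<exists>D. orthogonal_family D \<and> (\<forall>D'. orthogonal_family D' \<longrightarrow> card D' \<le> card D)"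
  proof (rule ex_has_greatest_nat)
    show "orthogonal_family {}"
      by (simp add: orthogonal_family_def)
    show "\<forall>D. orthogonal_family D \<longrightarrow> card D < Suc (card E)"
      using card_orthogonal_family_le by (simp add: le_imp_less_Suc)
  qed
  then obtain D where D: "orthogonal_family D"
    and max: "\<And>D'. orthogonal_family D' \<Longrightarrow> card D' \<le> card D"
    by metis
  note sub = orthogonal_familyD(2)[OF D] and nz = orthogonal_familyD(3)[OF D]
    and orth = orthogonal_familyD(4)[OF D]
  have irr: "irreducible_subrep U" if U: "U \<in> D" for U
  proof (rule ccontr)
    assume "\<not> irreducible_subrep U"
    then obtain U' where U': "subrep U'" "U' \<subseteq> U" "U' \<noteq> {0}" "U' \<noteq> U"
      using sub[OF U] nz[OF U] unfolding irreducible_subrep_def by blast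
    note p = proj_in[OF finite_E subrepD(1,2)[OF U'(1)]]
      proj_orthogonal[OF finite_E subrepD(1,2)[OF U'(1)]]
    \<comment> \<open>The orthogonal complement of \<open>U'\<close> in \<open>U\<close>. Replacing
      \<open>U\<close> by \<open>U'\<close> and \<open>X\<close> gains one member.\<close>
    define X where "X = {v \<in> V. \<forall>u\<in>U'. ip E v u = 0} \<inter> U"
    have "subrep {v \<in> V. \<forall>u\<in>U'. ip E v u = 0}"
      using subrepD[OF U'(1)] by (intro subrep_orthogonal)
    then have "subrep X"
      using sub[OF U] by (auto simp: X_def subrep_def intro: subspace_inter)
    moreover have "X \<noteq> {0}"
    proof
      assume "X = {0}"
      obtain v where v: "v \<in> U" "v \<notin> U'"
        using U' by blast
      have "v - proj E U' v \<in> U"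
        using v(1) p(1) U'(2) subrepD(1)[OF sub[OF U]] by (intro subspace_diff) auto
      then have "v - proj E U' v \<in> X"
        using p(2) subrepD(2)[OF sub[OF U]] by (auto simp: X_def)
      then have "v = proj E U' v"
        using \<open>X = {0}\<close> by (metis right_minus_eq singletonD)
      then show False
        using p(1)[of v] v(2) by simp
    qed
    moreover have D': "orthogonal_family (insert U' (D - {U}))" "U' \<notin> D - {U}"
      using orthogonal_family_insert[OF orthogonal_family_subset[OF D, of "D - {U}"] U'(1,3)]
        orth[OF _ U] U'(2) by blast+
    moreover have "ip E w x = 0" if "W \<in> insert U' (D - {U})" "w \<in> W" "x \<in> X" for W w x
    proof (cases "W = U'")
      case True
      then show ?thesis
        using that ip_eq_0_commute[of E w x] by (auto simp: X_def)
    next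
      case False
      then show ?thesis
        using that orth[OF _ U] by (auto simp: X_def)
    qed
    ultimately have "orthogonal_family (insert X (insert U' (D - {U})))"
      "X \<notin> insert U' (D - {U})"
      using orthogonal_family_insert by metis+
    then have "card (insert U' (D - {U})) < card D"
      using max[of "insert X (insert U' (D - {U}))"] orthogonal_familyD(1)[OF D] by simp
    then show False
      using D'(2) orthogonal_familyD(1)[OF D] card_Suc_Diff1[OF orthogonal_familyD(1)[OF D] U] by simp
  qed
  have complete: "v = 0" if v: "v \<in> V" "\<And>U u. \<lbrakk>U \<in> D; u \<in> U\<rbrakk> \<Longrightarrow> ip E v u = 0" for v
  proof (rule ccontr)
    assume "v \<noteq> 0"
    define X where "X = {v \<in> V. \<forall>u\<in>\<Union>D. ip E v u = 0}"
    have X: "subrep X"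
      unfolding X_def using subrepD[OF sub] by (intro subrep_orthogonal) blast+
    have "X \<noteq> {0}"
      using v \<open>v \<noteq> 0\<close> by (auto simp: X_def)
    have "ip E u x = 0" if "U \<in> D" "u \<in> U" "x \<in> X" for U u x
      using that ip_eq_0_commute[of E u x] by (auto simp: X_def)
    note ins = orthogonal_family_insert[OF D X \<open>X \<noteq> {0}\<close> this]
    show False
      using max[OF ins(1)] ins(2) orthogonal_familyD(1)[OF D] by simp
  qed
  have "orthogonal_decomposition D"
    using D irr complete unfolding orthogonal_decomposition_def by blast
  then show ?thesis
    by blast
qed

text \<open>Only the component in \<open>U\<close> is seen by vectors of \<open>U\<close>. This
  shows both that the projections sum up to the vector and that any components are the
  projections.\<close>

lemma ip_diff_component:
  assumes D: "orthogonal_family D" and x: "\<And>W. W \<in> D \<Longrightarrow> x W \<in> W" and U: "U \<in> D" "u \<in> U"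
  shows "ip E ((\<Sum>W\<in>D. x W) - x U) u = 0"
proof -
  have "(\<Sum>W\<in>D. x W) - x U = (\<Sum>W\<in>D - {U}. x W)"
    using orthogonal_familyD(1)[OF D] U(1) by (simp add: sum_diff1)
  moreover have "ip E (x W) u = 0" if "W \<in> D - {U}" for W
    using orthogonal_familyD(4)[OF D, of W U] U that x by simp
  ultimately show ?thesis
    by (simp add: ip_sum_left)
qed

lemma sum_proj:
  assumes D: "orthogonal_decomposition D" and v: "v \<in> V"
  shows "v = (\<Sum>U\<in>D. proj E U v)"
proof -
  have fam: "orthogonal_family D" and complete: "\<And>w. \<lbrakk>w \<in> V; \<forall>U\<in>D. \<forall>u\<in>U. ip E w u = 0\<rbrakk> \<Longrightarrow> w = 0"
    using D by (simp_all add: orthogonal_decomposition_def)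
  have sub: "subspace U" "U \<subseteq> V" if "U \<in> D" for U
    using subrepD(1,2)[OF orthogonal_familyD(2)[OF fam that]] .
  have p_in: "proj E U v \<in> U" if "U \<in> D" for U
    by (rule proj_in[OF finite_E sub[OF that]])
  have "v - (\<Sum>U\<in>D. proj E U v) = 0"
  proof (rule complete)
    show "v - (\<Sum>U\<in>D. proj E U v) \<in> V"
      using p_in sub(2) by (intro subspace_diff subspace_sum subspace_V v) blast
    show "\<forall>U\<in>D. \<forall>u\<in>U. ip E (v - (\<Sum>U\<in>D. proj E U v)) u = 0"
    proof (intro ballI)
      fix U u assume U: "U \<in> D" "u \<in> U"
      have "ip E (v - (\<Sum>U\<in>D. proj E U v)) u
          = ip E (v - proj E U v) u - ip E ((\<Sum>U\<in>D. proj E U v) - proj E U v) u"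
        by (simp add: ip_diff_left)
      also have "\<dots> = 0"
        using proj_orthogonal[OF finite_E sub[OF U(1)] U(2)]
          ip_diff_component[OF fam p_in U] by simp
      finally show "ip E (v - (\<Sum>U\<in>D. proj E U v)) u = 0" .
    qed
  qed
  then show ?thesis
    by simp
qed

text \<open>The choice in \<open>multiplicity\<close> thus has something to choose from. In an
  orthogonal decomposition the components exist by \<open>sum_proj\<close> and are forced to be the
  projections.\<close>

lemma exists_irreducible_decomposition: "\<exists>D. irreducible_decomposition D"
proof -
  obtain D where dec: "orthogonal_decomposition D"
    using exists_orthogonal_decomposition by blast
  then have D: "orthogonal_family D" "\<And>U. U \<in> D \<Longrightarrow> irreducible_subrep U"
    by (simp_all add: orthogonal_decomposition_def)
  note sub = subrepD[OF irreducibleD(1)[OF D(2)]]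
  have "\<exists>!x. x \<in> (\<Pi>\<^sub>E U\<in>D. U) \<and> v = (\<Sum>U\<in>D. x U)" if v: "v \<in> V" for v
  proof (rule ex1I)
    show "(\<lambda>U\<in>D. proj E U v) \<in> (\<Pi>\<^sub>E U\<in>D. U) \<and> v = (\<Sum>U\<in>D. (\<lambda>U\<in>D. proj E U v) U)"
    proof
      show "(\<lambda>U\<in>D. proj E U v) \<in> (\<Pi>\<^sub>E U\<in>D. U)"
        using proj_in[OF finite_E sub(1,2)] by simp
      have "v = (\<Sum>U\<in>D. proj E U v)"
        by (rule sum_proj[OF dec v])
      also have "\<dots> = (\<Sum>U\<in>D. (\<lambda>U\<in>D. proj E U v) U)"
        by (rule sum.cong) simp_all
      finally show "v = (\<Sum>U\<in>D. (\<lambda>U\<in>D. proj E U v) U)" .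
    qed
  next
    fix x assume x: "x \<in> (\<Pi>\<^sub>E U\<in>D. U) \<and> v = (\<Sum>U\<in>D. x U)"
    then have x_in: "x W \<in> W" if "W \<in> D" for W
      using that by blast
    show "x = (\<lambda>U\<in>D. proj E U v)"
    proof (rule extensionalityI)
      show "x \<in> extensional D"
        using x by (simp add: PiE_def)
      fix U assume U: "U \<in> D"
      have "proj E U v = x U"
        using ip_diff_component[OF D(1) x_in U] x
        by (intro proj_unique[OF finite_E sub(1,2)] x_in U) simp_all
      then show "x U = (\<lambda>U\<in>D. proj E U v) U"
        using U by simp
    qed simp
  qed
  then have "irreducible_decomposition D"
    using D(2) orthogonal_familyD(1)[OF D(1)] by (simp add: irreducible_decomposition_def)
  then show ?thesis
    by blast
qed

section \<open>Positivity and boundedness of multiplicities\<close>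

lemma multiplicity_witness:
  obtains D where "irreducible_decomposition D" "multiplicity U = card {W \<in> D. subrep_iso W U}"
proof -
  have "\<exists>D. irreducible_decomposition D \<and> multiplicity U = card {W \<in> D. subrep_iso W U}"
    unfolding multiplicity_def
    by (rule someI_ex) (use exists_irreducible_decomposition in blast)
  then show thesis
    using that by blast
qed

text \<open>If no summand were isomorphic to \<open>U\<close>, the projection to \<open>U\<close>
  would vanish on every summand by \<open>schur_bij\<close>. A unit vector of \<open>U\<close>,
  being a sum of vectors from the summands, would then be orthogonal to itself.\<close>

lemma multiplicity_pos:
  assumes U: "irreducible_subrep U"
  shows "multiplicity U > 0"
proof -
  obtain D where D: "irreducible_decomposition D"
    and mult: "multiplicity U = card {W \<in> D. subrep_iso W U}"
    by (rule multiplicity_witness)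
  note sub = subrepD[OF irreducibleD(1)[OF U]]
  note p = proj_in[OF finite_E sub(1,2)] proj_orthogonal[OF finite_E sub(1,2)]
  have "finite D" and irr: "\<And>W. W \<in> D \<Longrightarrow> irreducible_subrep W"
    using D by (auto simp: irreducible_decomposition_def)
  have "\<exists>W\<in>D. subrep_iso W U"
  proof (rule ccontr)
    assume no: "\<not> (\<exists>W\<in>D. subrep_iso W U)"
    have orth: "ip E w u = 0" if W: "W \<in> D" and w: "w \<in> W" and u: "u \<in> U" for W w u
    proof -
      have T: "intertwines W (proj E U)"
        by (rule intertwines_subset[OF intertwines_proj[OF irreducibleD(1)[OF U]]])
          (rule subrepD(2)[OF irreducibleD(1)[OF irr[OF W]]])
      have "proj E U w = 0"
        using schur_bij[OF irr[OF W] U T _ w] subrep_isoI[OF T] p(1) no W by blast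
      then show ?thesis
        using p(2)[OF u, of w] by simp
    qed
    obtain u where u: "u \<in> U" "nsq E u = 1"
      by (rule exists_unit_vector[OF irreducibleD(1,2)[OF U]])
    have "\<forall>v\<in>V. \<exists>!x. x \<in> (\<Pi>\<^sub>E W\<in>D. W) \<and> v = (\<Sum>W\<in>D. x W)"
      using D unfolding irreducible_decomposition_def by (elim conjE)
    then obtain x where x: "x \<in> (\<Pi>\<^sub>E W\<in>D. W)" "u = (\<Sum>W\<in>D. x W)"
      using u(1) sub(2) by (meson ex1_implies_ex subsetD)
    have "ip E u u = (\<Sum>W\<in>D. ip E (x W) u)"
      by (subst x(2)) (rule ip_sum_left)
    also have "\<dots> = 0"
      using x(1) orth u(1) by (intro sum.neutral) blast
    finally show False
      using u(2) by (simp add: ip_self)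
  qed
  then show ?thesis
    using \<open>finite D\<close> by (auto simp: mult card_gt_0_iff)
qed

text \<open>There may be infinitely many irreducible subrepresentations, but their multiplicities
  are at most \<open>card E\<close>. So the minimum is over a finite set, nonempty because of
  \<open>U\<close>, and is attained.\<close>

lemma min_nontrivial_multiplicity_bounds:
  assumes "irreducible_subrep U" "\<not> acts_trivially U"
  shows "min_nontrivial_multiplicity \<le> multiplicity U" "min_nontrivial_multiplicity > 0"
proof -
  let ?M = "multiplicity ` {U. irreducible_subrep U \<and> \<not> acts_trivially U}"
  have "multiplicity W \<le> card E" if "irreducible_subrep W" for W
    using multiplicity_witness[of W] copies_bound(1)[OF that] by metis
  then have "?M \<subseteq> {..card E}"
    by auto
  then have fin: "finite ?M"
    by (rule finite_subset) simp
  show "min_nontrivial_multiplicity \<le> multiplicity U"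
    unfolding min_nontrivial_multiplicity_def using assms fin by (intro Min_le) auto
  have "min_nontrivial_multiplicity \<in> ?M"
    unfolding min_nontrivial_multiplicity_def using assms fin by (intro Min_in) auto
  then show "min_nontrivial_multiplicity > 0"
    using multiplicity_pos by auto
qed

text \<open>The projection is fixed by the group, hence constant on \<open>E\<close> by
  transitivity, hence orthogonal to \<open>v\<close>. Being also orthogonal to its own residual, it
  has norm zero.\<close>

lemma proj_trivial_eq_0:
  assumes trans: "\<And>x y. \<lbrakk>x \<in> E; y \<in> E\<rbrakk> \<Longrightarrow> \<exists>g\<in>carrier G. \<phi> g x = y"
    and U: "subrep U" "acts_trivially U" and v: "(\<Sum>x\<in>E. v x) = 0"
  shows "proj E U v = 0"
proof -
  note p = proj_in[OF finite_E subrepD(1,2)[OF U(1)], of v]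
    proj_orthogonal[OF finite_E subrepD(1,2)[OF U(1)], of _ v]
  let ?p = "proj E U v"
  have const: "?p x = ?p y" if x: "x \<in> E" and y: "y \<in> E" for x y
  proof -
    obtain g where g: "g \<in> carrier G" "\<phi> g x = y"
      using trans[OF x y] by blast
    have "R g ?p = ?p"
      using U(2) g(1) p(1) by (simp add: acts_trivially_def)
    then have "R g ?p y = ?p y"
      by simp
    then show ?thesis
      using g x y action_eq_iff[OF g(1) y x] by (simp add: perm_rep_def)
  qed
  have "ip E v ?p = 0"
  proof (cases "E = {}")
    case False
    then obtain y where y: "y \<in> E"
      by blast
    have "ip E v ?p = (\<Sum>x\<in>E. v x * cnj (?p y))"
      unfolding ip_def using const[OF _ y] by (intro sum.cong) auto
    also have "\<dots> = 0"
      by (simp add: v flip: sum_distrib_right)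
    finally show ?thesis .
  qed (simp add: ip_def)
  then have "ip E ?p ?p = 0"
    using p(2)[OF p(1)] by (simp add: ip_diff_left)
  then show ?thesis
    using nsq_eq_0_iff[OF finite_E] p(1) subrepD(2)[OF U(1)] by (auto simp: ip_self)
qed

text \<open>The components of \<open>v\<close> in trivial summands vanish, and the others obey
  \<open>copies_bound\<close>. As \<open>conv S\<close> keeps each component in its summand, the
  squared norms add up on both sides. A nonzero \<open>v\<close> has a component in a nontrivial
  summand, which makes the minimum positive.\<close>

lemma
  assumes trans: "\<And>x y. \<lbrakk>x \<in> E; y \<in> E\<rbrakk> \<Longrightarrow> \<exists>g\<in>carrier G. \<phi> g x = y"
    and v: "v \<in> V" "(\<Sum>x\<in>E. v x) = 0"
  shows min_multiplicity_nsq_conv_le: "\<lbrakk>finite S; S \<subseteq> carrier G\<rbrakk> \<Longrightarrow>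
      real min_nontrivial_multiplicity * nsq E (conv S v)
        \<le> (\<Sum>x\<in>E. \<Sum>y\<in>E. (real (card {s \<in> S. \<phi> s y = x}))\<^sup>2) * nsq E v"
    and min_multiplicity_pos: "v \<noteq> 0 \<Longrightarrow> min_nontrivial_multiplicity > 0"
proof -
  obtain D where dec: "orthogonal_decomposition D"
    using exists_orthogonal_decomposition by blast
  then have D: "orthogonal_family D" "\<And>U. U \<in> D \<Longrightarrow> irreducible_subrep U"
    by (simp_all add: orthogonal_decomposition_def)
  note irr = irreducibleD(1)[OF D(2)]
  note sub = subrepD[OF irr]
  note orth = orthogonal_familyD(4)[OF D(1)]
  define p where "p U = proj E U v" for U
  have p_in: "p U \<in> U" if "U \<in> D" for U
    unfolding p_def by (rule proj_in[OF finite_E sub(1,2)[OF that]])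
  have v_eq: "v = (\<Sum>U\<in>D. p U)"
    unfolding p_def by (rule sum_proj[OF dec v(1)])
  have p_0: "p U = 0" if "U \<in> D" "acts_trivially U" for U
    unfolding p_def by (rule proj_trivial_eq_0[OF trans irr[OF that(1)] that(2) v(2)])
  show "min_nontrivial_multiplicity > 0" if "v \<noteq> 0"
  proof -
    obtain U where "U \<in> D" "p U \<noteq> 0"
      using \<open>v \<noteq> 0\<close> v_eq by (metis sum.neutral)
    then show ?thesis
      using p_0 D(2) min_nontrivial_multiplicity_bounds(2) by blast
  qed
  assume S: "finite S" "S \<subseteq> carrier G"
  let ?C = "\<Sum>x\<in>E. \<Sum>y\<in>E. (real (card {s \<in> S. \<phi> s y = x}))\<^sup>2"
  have le: "real min_nontrivial_multiplicity * nsq E (conv S (p U)) \<le> ?C * nsq E (p U)"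
    if U: "U \<in> D" for U
  proof (cases "acts_trivially U")
    case True
    then show ?thesis
      using p_0[OF U] by (simp add: conv_0 nsq_def)
  next
    case False
    \<comment> \<open>Two decompositions are in play: the orthogonal \<open>D\<close> splits
      \<open>v\<close>, while \<open>D'\<close> realises the chosen multiplicity of \<open>U\<close>
      and may fail to be orthogonal.\<close>
    obtain D' where D': "irreducible_decomposition D'"
      and mult: "multiplicity U = card {W \<in> D'. subrep_iso W U}"
      by (rule multiplicity_witness)
    have "real min_nontrivial_multiplicity * nsq E (conv S (p U))
        \<le> real (multiplicity U) * nsq E (conv S (p U))"
      using min_nontrivial_multiplicity_bounds(1)[OF D(2)[OF U] False]
      by (intro mult_right_mono nsq_nonneg) simp
    also have "\<dots> \<le> ?C * nsq E (p U)"
      unfolding mult by (rule copies_bound(2)[OF D(2)[OF U] D' S p_in[OF U]])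
    finally show ?thesis .
  qed
  have "conv S v = (\<Sum>U\<in>D. conv S (p U))"
  proof -
    have "R s (\<Sum>U\<in>D. p U) = (\<Sum>U\<in>D. R s (p U))" for s
      by (rule ext) (simp add: perm_rep_def sum_fun_apply)
    then show ?thesis
      unfolding conv_def by (subst v_eq) (simp add: sum.swap[of _ S D])
  qed
  moreover have "conv S (p U) \<in> U" if "U \<in> D" for U
    by (rule conv_closed[OF irr[OF that] S(2) p_in[OF that]])
  ultimately have "nsq E (conv S v) = (\<Sum>U\<in>D. nsq E (conv S (p U)))"
    using orth by (simp add: nsq_orthogonal_sum[OF orthogonal_familyD(1)[OF D(1)]])
  then have "real min_nontrivial_multiplicity * nsq E (conv S v)
      = (\<Sum>U\<in>D. real min_nontrivial_multiplicity * nsq E (conv S (p U)))"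
    by (simp add: sum_distrib_left)
  also have "\<dots> \<le> (\<Sum>U\<in>D. ?C * nsq E (p U))"
    by (rule sum_mono) (rule le)
  also have "\<dots> = ?C * nsq E v"
  proof -
    have "nsq E v = (\<Sum>U\<in>D. nsq E (p U))"
      unfolding v_eq by (rule nsq_orthogonal_sum[OF orthogonal_familyD(1)[OF D(1)]]) (use orth p_in in blast)
    then show ?thesis
      by (simp only: sum_distrib_left)
  qed
  finally show "real min_nontrivial_multiplicity * nsq E (conv S v) \<le> ?C * nsq E v" .
qed

text \<open>One factor of each square is at most \<open>l\<close>; the other sums to
  \<open>card S\<close> along every column.\<close>

lemma sum_transporter_squares_le:
  assumes S: "finite S" "S \<subseteq> carrier G"
    and l: "\<And>x y. \<lbrakk>x \<in> E; y \<in> E\<rbrakk> \<Longrightarrow> card {s \<in> S. \<phi> s y = x} \<le> l"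
  shows "(\<Sum>x\<in>E. \<Sum>y\<in>E. (real (card {s \<in> S. \<phi> s y = x}))\<^sup>2) \<le> real l * real (card S) * real (card E)"
proof -
  have "(\<Sum>x\<in>E. \<Sum>y\<in>E. (real (card {s \<in> S. \<phi> s y = x}))\<^sup>2)
      \<le> (\<Sum>x\<in>E. \<Sum>y\<in>E. real l * real (card {s \<in> S. \<phi> s y = x}))"
    unfolding power2_eq_square by (intro sum_mono mult_right_mono) (simp_all add: l)
  also have "\<dots> = real l * (\<Sum>y\<in>E. real (\<Sum>x\<in>E. card {s \<in> S. \<phi> s y = x}))"
    by (subst sum.swap) (simp add: sum_distrib_left)
  also have "\<dots> = real l * real (card S) * real (card E)"
    by (simp add: sum_card_transporter[OF S] mult_ac)
  finally show ?thesis .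
qed

end
section \<open>The action on cosets\<close>

text \<open>The orbit-stabilizer correspondence sending \<open>g <# H\<close> to
  \<open>\<phi> g \<omega>\<close>, together with its equivariance.\<close>

lemma (in group_action) exists_coset_bijection:
  assumes H: "H = stabilizer G \<phi> \<omega>" and \<omega>: "\<omega> \<in> E"
    and trans: "\<And>x y. \<lbrakk>x \<in> E; y \<in> E\<rbrakk> \<Longrightarrow> \<exists>g\<in>carrier G. \<phi> g x = y"
  obtains \<beta> where "bij_betw \<beta> (lcosets H) E"
    "\<And>g C. \<lbrakk>g \<in> carrier G; C \<in> lcosets H\<rbrakk> \<Longrightarrow> \<beta> (g <# C) = \<phi> g (\<beta> C)"
proof -
  interpret group G
    using group_hom by (rule group_hom.axioms(1))
  have H_sub: "subgroup H G"
    unfolding H by (rule stabilizer_subgroup[OF \<omega>])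
  have H_fix: "h \<in> H \<longleftrightarrow> h \<in> carrier G \<and> \<phi> h \<omega> = \<omega>" for h
    by (simp add: H stabilizer_def)
  \<comment> \<open>The chosen representative does not matter: two of them differ by an element of
    \<open>H\<close> on the right, which fixes \<open>\<omega>\<close>.\<close>
  define \<beta> where "\<beta> C = \<phi> (SOME g. g \<in> C) \<omega>" for C
  have \<beta>: "\<beta> (g <# H) = \<phi> g \<omega>" if g: "g \<in> carrier G" for g
  proof -
    have "(SOME a. a \<in> g <# H) \<in> g <# H"
      using lcos_self[OF g H_sub] by (rule someI)
    then obtain h where h: "h \<in> H" "(SOME a. a \<in> g <# H) = g \<otimes> h"
      unfolding l_coset_def by blast
    then show ?thesis
      using g \<omega> H_fix composition_rule[of \<omega> g h] by (simp add: \<beta>_def)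
  qed
  have coset: "\<exists>g\<in>carrier G. C = g <# H" if "C \<in> lcosets H" for C
    using that by (auto simp: LCOSETS_def)
  have "inj_on \<beta> (lcosets H)"
  proof (rule inj_onI)
    fix C D assume "C \<in> lcosets H" "D \<in> lcosets H" and eq: "\<beta> C = \<beta> D"
    then obtain a b where a: "a \<in> carrier G" "C = a <# H" and b: "b \<in> carrier G" "D = b <# H"
      using coset by metis
    have "\<phi> a \<omega> = \<phi> b \<omega>"
      using eq a b \<beta> by simp
    then have "\<phi> (inv a) (\<phi> b \<omega>) = \<omega>"
      using orbit_sym_aux[OF a(1) \<omega>] by simp
    then have "inv a \<otimes> b \<in> H"
      using a b \<omega> by (simp add: H_fix composition_rule)
    then have "a \<otimes> (inv a \<otimes> b) \<in> a <# H"
      unfolding l_coset_def by blast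
    moreover have "a \<otimes> (inv a \<otimes> b) = b"
      using a b by (simp flip: m_assoc)
    ultimately have "b \<in> a <# H"
      by simp
    then show "C = D"
      unfolding a(2) b(2) by (rule l_repr_independence[OF _ a(1) H_sub])
  qed
  moreover have "\<beta> ` (lcosets H) = E"
  proof
    show "\<beta> ` (lcosets H) \<subseteq> E"
      using coset \<beta> element_image[OF _ \<omega>] by fastforce
    show "E \<subseteq> \<beta> ` (lcosets H)"
    proof
      fix x assume "x \<in> E"
      then obtain g where "g \<in> carrier G" "\<phi> g \<omega> = x"
        using trans[OF \<omega>] by blast
      then show "x \<in> \<beta> ` (lcosets H)"
        using \<beta>[of g] by (force simp: LCOSETS_def)
    qed
  qed
  moreover have "\<beta> (g <# C) = \<phi> g (\<beta> C)" if g: "g \<in> carrier G" and C: "C \<in> lcosets H" for g C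
  proof -
    obtain a where a: "a \<in> carrier G" "C = a <# H"
      using coset[OF C] by blast
    then have "g <# C = (g \<otimes> a) <# H"
      using g lcos_m_assoc[OF subgroup.subset[OF H_sub]] by simp
    then show ?thesis
      using a g \<omega> \<beta> by (simp add: composition_rule)
  qed
  ultimately show thesis
    using that by (auto simp: bij_betw_def)
qed

text \<open>If \<open>s\<close> carries \<open>a <# H\<close> to \<open>b <# H\<close>, then
  \<open>s \<otimes> a\<close> lies in \<open>b <# H\<close>, so \<open>s\<close> lies in the
  two-sided translate of \<open>H\<close> by \<open>b\<close> and \<open>inv a\<close>.\<close>

lemma (in group) card_coset_transporter_le:
  assumes H: "subgroup H G" and fin: "finite (carrier G)" and S: "S \<subseteq> carrier G"
    and C: "C \<in> lcosets H" and D: "D \<in> lcosets H"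
  shows "card {s \<in> S. coset_action G H s D = C} \<le> max_coset_inter G H S"
proof -
  obtain a b where a: "a \<in> carrier G" "D = a <# H" and b: "b \<in> carrier G" "C = b <# H"
    using C D by (auto simp: LCOSETS_def)
  have "{s \<in> S. coset_action G H s D = C} \<subseteq> ((b <# H) #> inv a) \<inter> S"
  proof
    fix s assume s: "s \<in> {s \<in> S. coset_action G H s D = C}"
    then have s_in: "s \<in> carrier G"
      using S by blast
    have "s <# (a <# H) = b <# H"
      using s D a b by (simp add: coset_action_def)
    then have "(s \<otimes> a) <# H = b <# H"
      using lcos_m_assoc[OF subgroup.subset[OF H] s_in a(1)] by simp
    then have "s \<otimes> a \<in> b <# H"
      using lcos_self[of "s \<otimes> a", OF _ H] s_in a(1) by simp
    then have "(s \<otimes> a) \<otimes> inv a \<in> (b <# H) #> inv a"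
      unfolding r_coset_def by blast
    then show "s \<in> ((b <# H) #> inv a) \<inter> S"
      using s s_in a(1) by (simp add: m_assoc)
  qed
  then have "card {s \<in> S. coset_action G H s D = C} \<le> card (((b <# H) #> inv a) \<inter> S)"
    using finite_subset[OF S fin] by (intro card_mono) auto
  also have "\<dots> \<le> max_coset_inter G H S"
    unfolding max_coset_inter_def
  proof (rule Max_ge)
    show "finite {card (((g\<^sub>1 <# H) #> g\<^sub>2) \<inter> S) |g\<^sub>1 g\<^sub>2. g\<^sub>1 \<in> carrier G \<and> g\<^sub>2 \<in> carrier G}"
      using fin by (intro finite_image_set2) simp_all
    show "card (((b <# H) #> inv a) \<inter> S)
        \<in> {card (((g\<^sub>1 <# H) #> g\<^sub>2) \<inter> S) |g\<^sub>1 g\<^sub>2. g\<^sub>1 \<in> carrier G \<and> g\<^sub>2 \<in> carrier G}"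
      using a b inv_closed by blast
  qed
  finally show ?thesis .
qed

section \<open>The estimate on \<open>\<Omega>\<close>, transferred from the cosets of
  \<open>H\<close>\<close>

theorem theorem3:
  fixes G :: "('g, 'm) monoid_scheme" (structure)
    and \<Omega> :: "'b set"
    and \<phi> :: "'g \<Rightarrow> 'b \<Rightarrow> 'b"
    and \<omega> :: 'b
    and H S :: "'g set"
    and f :: "'b \<Rightarrow> real"
  assumes "transitive_action G \<Omega> \<phi>"
    and "finite (carrier G)"
    and "finite \<Omega>"
    and "card \<Omega> \<ge> 2"
    and "\<omega> \<in> \<Omega>"
    and "H = stabilizer G \<phi> \<omega>"
    and "S \<subseteq> carrier G"
    and "(\<Sum>x\<in>\<Omega>. f x) = 0"
  shows "L2_set (convolution G \<phi> (indicator S) f) \<Omega>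
    \<le> sqrt (real (max_coset_inter G H S) * real (card \<Omega>) / real (min_mult G H))
        * L2_set (indicator S) (carrier G) * L2_set f \<Omega>"
proof -
  interpret act: transitive_action G \<Omega> \<phi> by fact
  interpret group G
    using act.group_hom by (rule group_hom.axioms(1))
  have H: "subgroup H G"
    unfolding assms(6) by (rule act.stabilizer_subgroup[OF assms(5)])
  have "finite S"
    using assms(2,7) by (rule rev_finite_subset)
  let ?E = "lcosets H"
  \<comment> \<open>\<open>min_mult\<close> is computed on the cosets of \<open>H\<close>, so
    \<open>f\<close> will be pulled back along an equivariant bijection.\<close>
  obtain \<beta> where bij: "bij_betw \<beta> ?E \<Omega>"
    and equiv: "\<And>g C. \<lbrakk>g \<in> carrier G; C \<in> ?E\<rbrakk> \<Longrightarrow> \<beta> (g <# C) = \<phi> g (\<beta> C)"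
    using act.exists_coset_bijection[OF assms(6,5) act.unique_orbit] by metis
  have "finite ?E"
    using bij assms(3) by (simp add: bij_betw_finite)
  interpret coset: finite_action G ?E "coset_action G H"
    by (intro finite_action.intro finite_action_axioms.intro group_action_coset_action
        group_axioms H \<open>finite ?E\<close>)
  have sum_\<beta>: "(\<Sum>C\<in>?E. k (\<beta> C)) = (\<Sum>x\<in>\<Omega>. k x)" for k :: "'b \<Rightarrow> real"
    by (rule sum.reindex_bij_betw[OF bij])
  have trans: "\<exists>g\<in>carrier G. coset_action G H g C = D" if C: "C \<in> ?E" and D: "D \<in> ?E" for C D
  proof -
    obtain g where g: "g \<in> carrier G" "\<phi> g (\<beta> C) = \<beta> D"
      using act.unique_orbit bij_betwE[OF bij] C D by metis
    have "g <# C = coset_action G H g C"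
      using C by (simp add: coset_action_def)
    moreover have "coset_action G H g C \<in> ?E"
      using coset.element_image[OF g(1) C] by simp
    moreover have "\<beta> (g <# C) = \<beta> D"
      using equiv[OF g(1) C] g(2) by simp
    ultimately show ?thesis
      using g(1) D bij_betw_imp_inj_on[OF bij] by (metis inj_onD)
  qed
  define v where "v C = (if C \<in> ?E then complex_of_real (f (\<beta> C)) else 0)" for C
  define F where "F = convolution G \<phi> (indicator S) f"
  define m where "m = min_mult G H"
  define l where "l = max_coset_inter G H S"
  have m_eq: "m = coset.min_nontrivial_multiplicity"
    by (simp add: m_def min_mult_def)
  have v: "v \<in> perm_space ?E"
    by (simp add: v_def perm_space_def)
  have "(\<Sum>C\<in>?E. v C) = complex_of_real (\<Sum>C\<in>?E. f (\<beta> C))"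
    by (simp add: v_def)
  then have v_sum: "(\<Sum>C\<in>?E. v C) = 0"
    by (simp add: sum_\<beta> assms(8))
  have nsq_v: "nsq ?E v = (\<Sum>x\<in>\<Omega>. (f x)\<^sup>2)"
    by (simp add: nsq_def v_def sum_\<beta>[of "\<lambda>x. (f x)\<^sup>2"])
  have F_eq: "coset.conv S v C = complex_of_real (F (\<beta> C))" if C: "C \<in> ?E" for C
  proof -
    have R: "coset.R s v C = complex_of_real (f (\<phi> (inv s) (\<beta> C)))" if "s \<in> S" for s
    proof -
      have s: "inv s \<in> carrier G"
        using that assms(7) by blast
      have "coset_action G H (inv s) C = inv s <# C"
        using C by (simp add: coset_action_def)
      moreover have "coset_action G H (inv s) C \<in> ?E"
        using coset.element_image[OF s C] by simp
      ultimately show ?thesis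
        using C equiv[OF s C] by (simp add: perm_rep_def v_def)
    qed
    have "F (\<beta> C) = (\<Sum>g\<in>carrier G. if g \<in> S then f (\<phi> (inv g) (\<beta> C)) else 0)"
      unfolding F_def convolution_def by (intro sum.cong) (auto simp: indicator_def)
    also have "\<dots> = (\<Sum>s\<in>S. f (\<phi> (inv s) (\<beta> C)))"
      using assms(7) by (simp add: sum.If_cases[OF assms(2)] Int_absorb1)
    finally show ?thesis
      by (simp add: coset.conv_def sum_fun_apply R)
  qed
  have nsq_conv: "nsq ?E (coset.conv S v) = (\<Sum>x\<in>\<Omega>. (F x)\<^sup>2)"
    by (simp add: nsq_def F_eq sum_\<beta>[of "\<lambda>x. (F x)\<^sup>2"])
  have "real m * nsq ?E (coset.conv S v)
      \<le> (\<Sum>x\<in>?E. \<Sum>y\<in>?E. (real (card {s \<in> S. coset_action G H s y = x}))\<^sup>2) * nsq ?E v"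
    unfolding m_eq
    by (rule coset.min_multiplicity_nsq_conv_le[OF trans v v_sum \<open>finite S\<close> assms(7)])
  also have "\<dots> \<le> real l * real (card S) * real (card ?E) * nsq ?E v"
    unfolding l_def using card_coset_transporter_le[OF H assms(2,7)]
    by (intro mult_right_mono coset.sum_transporter_squares_le nsq_nonneg \<open>finite S\<close> assms(7))
  finally have bound: "real m * (\<Sum>x\<in>\<Omega>. (F x)\<^sup>2)
      \<le> real l * real (card S) * real (card \<Omega>) * (\<Sum>x\<in>\<Omega>. (f x)\<^sup>2)"
    by (simp add: nsq_conv nsq_v bij_betw_same_card[OF bij])
  have L2_S: "L2_set (indicator S) (carrier G) = sqrt (real (card S))"
  proof -
    have "(\<Sum>g\<in>carrier G. (indicator S g :: real)\<^sup>2) = (\<Sum>g\<in>carrier G. if g \<in> S then 1 else 0)"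
      by (intro sum.cong) (auto simp: indicator_def)
    also have "\<dots> = real (card S)"
      using assms(7) by (simp add: sum.If_cases[OF assms(2)] Int_absorb1)
    finally show ?thesis
      by (simp add: L2_set_def)
  qed
  show ?thesis
  \<comment> \<open>Dividing by \<open>m\<close> requires \<open>m > 0\<close>, which a nonzero
    \<open>v\<close> provides; for \<open>v = 0\<close> the left-hand side is zero.\<close>
  proof (cases "v = 0")
    case True
    then have "coset.conv S v = 0"
      by (simp add: coset.conv_0)
    then have "(\<Sum>x\<in>\<Omega>. (F x)\<^sup>2) = 0"
      using nsq_conv by (simp add: nsq_def)
    then show ?thesis
      by (simp add: L2_set_def F_def sum_nonneg)
  next
    case False
    have "m > 0"
      unfolding m_eq by (rule coset.min_multiplicity_pos[OF _ v v_sum False]) (rule trans)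
    then have "(\<Sum>x\<in>\<Omega>. (F x)\<^sup>2)
        \<le> real l * real (card \<Omega>) / real m * real (card S) * (\<Sum>x\<in>\<Omega>. (f x)\<^sup>2)"
      using bound by (simp add: field_simps)
    then have "sqrt (\<Sum>x\<in>\<Omega>. (F x)\<^sup>2)
        \<le> sqrt (real l * real (card \<Omega>) / real m) * sqrt (real (card S)) * sqrt (\<Sum>x\<in>\<Omega>. (f x)\<^sup>2)"
      by (simp flip: real_sqrt_mult)
    then show ?thesis
      unfolding L2_S unfolding L2_set_def F_def m_def l_def .
  qed
qed

end
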